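(* Let $s\ge 1$ and let $F\in A[X_1,\dots,X_s]$. Then $$\mathfrak L(F,Z)=\exp_C\Big(\sum_{a\in A_+}\frac{a*(FZ)}{a}\Big)\in A[X_1,\dots,X_s,Z].$$
   Context: $\mathbb F_q$ is a finite field with $q$ elements, $A=\mathbb F_q[\theta]$, $K=\mathbb F_q(\theta)$, $A_+$ is the set of monic elements of $A$. $\mathbb C_\infty$ is the completion of an algebraic closure of $K_\infty=\mathbb F_q((1/\theta))$. The Carlitz module is the $\mathbb F_q$-algebra morphism $a\mapsto C_a$ from $A$ to the ring of $\mathbb F_q$-linear polynomials over $A$ (under composition) with $C_\theta(X)=\theta X+X^q$. $X_1,\dots,X_s,Z$ are indeterminates. For $a\in A\setminus\{0\}$ and $G(X_1,\dots,X_s,Z)\in\mathbb C_\infty[X_1,\dots,X_s][[Z]]$ put $$a*G=G\big(C_a(X_1),\dots,C_a(X_s),Z^{q^{\deg_\theta a}}\big).$$ Thus $\sum_{a\in A_+}\frac{a*(FZ)}{a}=\sum_{d\ge0}Z^{q^d}\sum_{a\in A_+,\ \deg a=d}\frac{F(C_a(X_1),\dots,C_a(X_s))}{a}$ is a well-defined element of $\mathbb C_\infty[X_1,\dots,X_s][[Z]]$ for $F \in \mathbb C_\infty[X_1,\dots,X_s]$. Let $D_0=1$, $D_i=(\theta^{q^i}-\theta)D_{i-1}^q$ for $i\ge1$, and $\exp_C(G)=\sum_{i\ge0}G^{q^i}/D_i$ for $G\in Z\,\mathbb C_\infty[X_1,\dots,X_s][[Z]]$ ($Z$-adic convergence). 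*)

theory Defs
  imports
    "HOL-Analysis.Infinite_Sum"
    "HOL-Algebra.Algebraic_Closure_Type"
    "HOL-Algebra.Sylow"
    "HOL-Library.Poly_Mapping"
    "HOL-Library.Cardinality"
begin

hide_const (open) Divisibility.prime Polynomials.degree Polynomials.lead_coeff
  up_ring.coeff up_ring.monom

section \<open>The field of constants\<close>

text \<open>
  \<open>\<bbbF>\<^sub>q\<close> is an arbitrary type \<open>'q\<close> of class \<open>finite_field\<close>, with \<open>q = CARD('q)\<close>, and
  \<open>A = \<bbbF>\<^sub>q[\<theta>]\<close> is the type \<open>'q poly\<close>, with \<open>\<theta> = [:0, 1:]\<close>.
\<close>

lemma card_finite_field_prime_power:
  obtains n where "n > 0" "card (UNIV :: 'q::finite_field set) = CHAR('q) ^ n"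
proof -
  define p where "p = CHAR('q)"
  have p: "prime p" unfolding p_def by (rule prime_CHAR_semidom) simp
  have "r = p" if r: "prime r" "r dvd CARD('q)" for r :: nat
  proof -
    define G :: "'q monoid" where "G = \<lparr>carrier = UNIV, mult = (+), one = 0\<rparr>"
    interpret G: group G
      by (rule groupI) (auto simp: G_def add.assoc intro: exI[of _ "- x" for x] left_minus)
    have ord: "Coset.order G = CARD('q)" by (simp add: Coset.order_def G_def)
    have pow: "x [^]\<^bsub>G\<^esub> n = of_nat n * x" for x :: 'q and n :: nat
      by (induction n) (auto simp: nat_pow_def G_def algebra_simps)
    obtain m where m: "CARD('q) = r ^ 1 * m" using r by auto
    obtain H where H: "subgroup H G" "card H = r ^ 1"
      using sylow_thm[of r G 1 m] r m ord G.is_group by (auto simp: G_def)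
    have fin: "finite H" by simp
    have "\<exists>x\<in>H. x \<noteq> 0"
    proof (rule ccontr)
      assume "\<not> ?thesis"
      hence "H \<subseteq> {0}" by auto
      hence "card H \<le> 1" using card_mono[of "{0}" H] by simp
      with H(2) prime_gt_1_nat[OF r(1)] show False by simp
    qed
    then obtain x where x: "x \<in> H" "x \<noteq> 0" by auto
    interpret H: group "G\<lparr>carrier := H\<rparr>" using H(1) G.subgroup_imp_group by blast
    have "x [^]\<^bsub>G\<lparr>carrier := H\<rparr>\<^esub> Coset.order (G\<lparr>carrier := H\<rparr>) = \<one>\<^bsub>G\<lparr>carrier := H\<rparr>\<^esub>"
      by (rule H.pow_order_eq_1) (use x in auto)
    hence "x [^]\<^bsub>G\<^esub> r = 0"
      using H(2) by (simp add: Coset.order_def nat_pow_def G_def)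
    hence "of_nat r = (0::'q)" using x(2) pow by simp
    hence "p dvd r" by (simp add: of_nat_eq_0_iff_char_dvd p_def)
    with p r(1) show "r = p" using primes_dvd_imp_eq by blast
  qed
  hence sub: "prime_factors (CARD('q)) \<subseteq> {p}" by (auto simp: in_prime_factors_iff)
  have ne: "CARD('q) \<noteq> 0" by simp
  define n where "n = multiplicity p (CARD('q))"
  have eq: "CARD('q) = p ^ n"
  proof -
    have "CARD('q) = (\<Prod>r\<in>prime_factors (CARD('q)). r ^ multiplicity r (CARD('q)))"
      using prime_factorization_nat[of "CARD('q)"] ne by simp
    also have "\<dots> = (\<Prod>r\<in>{p}. r ^ multiplicity r (CARD('q)))"
      by (rule prod.mono_neutral_left) (use sub p in \<open>auto simp: prime_factors_multiplicity\<close>)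
    finally show ?thesis by (simp add: n_def)
  qed
  have "CARD('q) > 1"
    using card_mono[of "UNIV :: 'q set" "{0, 1}"] by simp
  hence "n > 0" using eq by (cases n) auto
  with eq show ?thesis using that p_def by blast
qed


section \<open>The field \<open>\<bbbC>\<^sub>\<infinity>\<close>\<close>

text \<open>
  \<open>K\<^sub>\<infinity> = \<bbbF>\<^sub>q((1/\<theta>))\<close> is the type \<open>'q fls\<close>; the uniformiser \<^const>\<open>fls_X\<close> is \<open>1/\<theta>\<close>, so that \<open>\<theta>\<close> is
  \<^const>\<open>fls_X_inv\<close> and the absolute value of \<open>f \<noteq> 0\<close>, normalised by \<open>|\<theta>| = q\<close>, is
  \<open>q powi (- fls_subdegree f)\<close>. The locale says that \<open>'c\<close>, with \<open>|x| = dist x 0\<close>, is a completion,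
  via \<open>emb\<close>, of the algebraic closure of \<open>K\<^sub>\<infinity>\<close> with respect to an absolute value extending that
  of \<open>K\<^sub>\<infinity>\<close>. Such an extension is unique, so this determines \<open>'c\<close> up to isometric isomorphism.
\<close>

locale C_infinity =
  fixes emb :: "'q::finite_field fls alg_closure \<Rightarrow> 'c::{field, complete_space}"
  assumes emb_1: "emb 1 = 1"
    and emb_add: "emb (x + y) = emb x + emb y"
    and emb_mult: "emb (x * y) = emb x * emb y"
    and dist_diff: "dist (u::'c) v = dist (u - v) 0"
    and dist_mult_0: "dist (u * v :: 'c) 0 = dist u 0 * dist v 0"
    and dist_ultra: "dist (u + v :: 'c) 0 \<le> max (dist u 0) (dist v 0)"
    and dist_emb: "f \<noteq> 0 \<Longrightarrow> dist (emb (to_ac f)) 0 = real CARD('q) powi (- fls_subdegree f)"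
    and dense_emb: "closure (range emb) = UNIV"

definition A_emb :: "('q::finite_field fls alg_closure \<Rightarrow> 'c::field) \<Rightarrow> 'q poly \<Rightarrow> 'c" where
  "A_emb emb a = emb (to_ac (poly (map_poly fls_const a) fls_X_inv))"

definition A_plus :: "'q::finite_field poly set" where
  "A_plus = {a. lead_coeff a = 1}"


section \<open>The Carlitz module\<close>

definition carlitz_theta :: "'q::finite_field poly poly" where
  "carlitz_theta = monom [:0, 1:] 1 + monom 1 CARD('q)"

text \<open>
  \<open>C\<^sub>a = \<Sum>\<^sub>i a\<^sub>i C\<^sub>\<theta>\<^sup>i\<close> for \<open>a = \<Sum>\<^sub>i a\<^sub>i \<theta>\<^sup>i\<close>, powers being taken with respect to composition. The
  lemmas below show that this is the \<open>\<bbbF>\<^sub>q\<close>-algebra morphism with the prescribed value at \<open>\<theta>\<close>.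
\<close>

definition carlitz :: "'q::finite_field poly \<Rightarrow> 'q poly poly" where
  "carlitz a = (\<Sum>i\<le>degree a. smult [:coeff a i:] (((pcompose carlitz_theta) ^^ i) [:0, 1:]))"


lemma add_power_card:
  fixes x y :: "'r::comm_ring_1"
  assumes "CHAR('r) = CHAR('q::finite_field)"
  shows "(x + y) ^ CARD('q) = x ^ CARD('q) + y ^ CARD('q)"
proof -
  obtain n where n: "CARD('q) = CHAR('q) ^ n"
    using card_finite_field_prime_power by metis
  have "prime CHAR('q)" by (rule prime_CHAR_semidom) simp
  thus ?thesis using n assms by (intro freshmans_dream') auto
qed

lemma pcompose_carlitz_theta:
  "pcompose carlitz_theta f = smult [:0, 1:] f + f ^ CARD('q)"
  for f :: "'q::finite_field poly poly"
proof -
  have *: "pcompose (monom 1 n) f = f ^ n" for n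
    by (induction n) (simp_all add: monom_Suc pcompose_pCons pcompose_1 monom_0)
  have "monom [:0, 1:] 1 = smult [:0, 1:] (monom (1 :: 'q poly) 1)"
    by (simp add: smult_monom)
  thus ?thesis unfolding carlitz_theta_def
    by (simp only: pcompose_add pcompose_smult *) simp
qed

lemma pcompose_carlitz_theta_add:
  "pcompose carlitz_theta (f + g) = pcompose carlitz_theta f + pcompose carlitz_theta g"
  for f g :: "'q::finite_field poly poly"
  by (simp add: pcompose_carlitz_theta add_power_card[where ?'q = 'q] smult_add_right)

lemma pcompose_carlitz_theta_smult:
  "pcompose carlitz_theta (smult [:c:] f) = smult [:c:] (pcompose carlitz_theta f)"
  for f :: "'q::finite_field poly poly"
  by (simp add: pcompose_carlitz_theta smult_power finite_field_power_card_eq_same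
      poly_const_pow smult_add_right mult.commute)

lemma pcompose_carlitz_theta_sum:
  "pcompose carlitz_theta (sum f S) = (\<Sum>i\<in>S. pcompose carlitz_theta (f i))"
  for f :: "'i \<Rightarrow> 'q::finite_field poly poly"
proof (induction S rule: infinite_finite_induct)
  case (insert x S)
  thus ?case by (simp add: pcompose_carlitz_theta_add)
qed (simp_all add: pcompose_carlitz_theta zero_power)

lemma carlitz_altdef:
  assumes "degree a \<le> n"
  shows "carlitz a = (\<Sum>i\<le>n. smult [:coeff a i:] (((pcompose carlitz_theta) ^^ i) [:0, 1:]))"
  unfolding carlitz_def
  by (rule sum.mono_neutral_left) (use assms in \<open>auto simp: coeff_eq_0\<close>)

lemma carlitz_add: "carlitz (a + b) = carlitz a + carlitz b"
proof -
  define n where "n = max (degree a) (degree b)"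
  have n: "degree a \<le> n" "degree b \<le> n" "degree (a + b) \<le> n"
    by (auto simp: n_def degree_add_le)
  have pc: "[:x + y:] = [:x:] + [:y:]" for x y :: 'a by simp
  show ?thesis
    unfolding n[THEN carlitz_altdef] coeff_add pc smult_add_left sum.distrib ..
qed

lemma carlitz_const: "carlitz [:c:] = [:0, [:c:]:]"
  by (simp add: carlitz_def)

lemma carlitz_1: "carlitz 1 = [:0, 1:]"
  using carlitz_const[of 1] by (simp add: one_pCons)

lemma carlitz_pCons: "carlitz (pCons c a) = smult [:c:] [:0, 1:] + pcompose carlitz_theta (carlitz a)"
proof -
  have "degree (pCons c a) \<le> Suc (degree a)" by (rule degree_pCons_le)
  from carlitz_altdef[OF this] show ?thesis
    by (simp only: sum.atMost_Suc_shift)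
       (simp add: carlitz_def pcompose_carlitz_theta_sum pcompose_carlitz_theta_smult)
qed

lemma carlitz_theta: "carlitz [:0, 1:] = carlitz_theta"
proof -
  have "carlitz [:0, 1:] = pcompose carlitz_theta (carlitz 1)"
    using carlitz_pCons[of 0 1] by (simp add: one_pCons)
  thus ?thesis by (simp add: carlitz_1 del: One_nat_def)
qed

lemma carlitz_add_right: "pcompose (carlitz a) (f + g) = pcompose (carlitz a) f + pcompose (carlitz a) g"
  by (induction a)
     (simp_all add: carlitz_const[of 0, simplified] carlitz_pCons pcompose_add pcompose_pCons
        pcompose_smult smult_add_right pcompose_carlitz_theta_add flip: pcompose_assoc)

lemma carlitz_smult: "carlitz (smult c a) = smult [:c:] (carlitz a)"
  by (induction a)
     (simp_all add: carlitz_const[of 0, simplified] carlitz_pCons smult_add_right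
        pcompose_carlitz_theta_smult)

lemma carlitz_mult: "carlitz (a * b) = pcompose (carlitz a) (carlitz b)"
proof (induction a)
  case 0
  show ?case by (simp add: carlitz_const[of 0, simplified])
next
  case (pCons c a)
  have "carlitz (pCons c a * b) = carlitz (smult c b) + carlitz (pCons 0 (a * b))"
    by (simp add: carlitz_add)
  also have "\<dots> = smult [:c:] (carlitz b) + pcompose carlitz_theta (pcompose (carlitz a) (carlitz b))"
    by (simp add: carlitz_smult carlitz_pCons pCons.IH)
  also have "\<dots> = pcompose (carlitz (pCons c a)) (carlitz b)"
    by (simp add: carlitz_pCons pcompose_add pcompose_pCons pcompose_smult flip: pcompose_assoc)
  finally show ?case .
qed


section \<open>Polynomials in \<open>X\<^sub>1, \<dots>, X\<^sub>s\<close> and power series in \<open>Z\<close>\<close>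

text \<open>
  A polynomial is a finitely supported map from exponent vectors to coefficients, where exponent
  vectors are finitely supported maps \<open>nat \<Rightarrow>\<^sub>0 nat\<close>. Variables are indexed by \<^typ>\<open>nat\<close>; those allowed
  in \<open>\<bbbC>\<^sub>\<infinity>[X\<^sub>1,\<dots>,X\<^sub>s]\<close> are the ones with index in \<open>{1..s}\<close>.
\<close>

type_synonym 'c mpol = "(nat \<Rightarrow>\<^sub>0 nat) \<Rightarrow>\<^sub>0 'c"

definition mconst :: "'c::zero \<Rightarrow> 'c mpol" where
  "mconst c = Poly_Mapping.single 0 c"

definition mvar :: "nat \<Rightarrow> 'c::zero_neq_one mpol" where
  "mvar i = Poly_Mapping.single (Poly_Mapping.single i 1) 1"

definition msubst :: "(nat \<Rightarrow> 'c::comm_ring_1 mpol) \<Rightarrow> 'c mpol \<Rightarrow> 'c mpol" where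
  "msubst g p = (\<Sum>m\<in>Poly_Mapping.keys p. mconst (Poly_Mapping.lookup p m) *
                 (\<Prod>i\<in>Poly_Mapping.keys m. g i ^ Poly_Mapping.lookup m i))"

text \<open>\<open>A[X\<^sub>1,\<dots>,X\<^sub>s]\<close> and \<open>A[X\<^sub>1,\<dots>,X\<^sub>s,Z]\<close>, as subsets of \<open>\<bbbC>\<^sub>\<infinity>[X\<^sub>1,X\<^sub>2,\<dots>]\<close> and \<open>\<bbbC>\<^sub>\<infinity>[X\<^sub>1,X\<^sub>2,\<dots>][[Z]]\<close>.\<close>

definition A_mpol :: "('q::finite_field fls alg_closure \<Rightarrow> 'c::field) \<Rightarrow> nat \<Rightarrow> 'c mpol set" where
  "A_mpol emb s = {p. (\<forall>m\<in>Poly_Mapping.keys p. Poly_Mapping.keys m \<subseteq> {1..s}) \<and>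
                      (\<forall>m. Poly_Mapping.lookup p m \<in> range (A_emb emb))}"

definition A_mpol_Z :: "('q::finite_field fls alg_closure \<Rightarrow> 'c::field) \<Rightarrow> nat \<Rightarrow> 'c mpol fps set" where
  "A_mpol_Z emb s = {G. finite {n. fps_nth G n \<noteq> 0} \<and> (\<forall>n. fps_nth G n \<in> A_mpol emb s)}"


section \<open>The operators \<open>a * G\<close>, \<open>exp\<^sub>C\<close> and the series \<open>L(F, Z)\<close>\<close>

definition carlitz_at ::
    "('q::finite_field fls alg_closure \<Rightarrow> 'c::field) \<Rightarrow> 'q poly \<Rightarrow> 'c mpol \<Rightarrow> 'c mpol" where
  "carlitz_at emb a Y = poly (map_poly (\<lambda>b. mconst (A_emb emb b)) (carlitz a)) Y"

definition star ::
    "('q::finite_field fls alg_closure \<Rightarrow> 'c::field) \<Rightarrow> 'q poly \<Rightarrow> 'c mpol fps \<Rightarrow> 'c mpol fps" where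
  "star emb a G = fps_compose (Abs_fps (\<lambda>n. msubst (\<lambda>i. carlitz_at emb a (mvar i)) (fps_nth G n)))
                    (fps_X ^ (CARD('q) ^ degree a))"

primrec carlitz_D :: "nat \<Rightarrow> 'q::finite_field poly" where
  "carlitz_D 0 = 1"
| "carlitz_D (Suc i) = ([:0, 1:] ^ (CARD('q) ^ Suc i) - [:0, 1:]) * carlitz_D i ^ CARD('q)"

text \<open>
  The topology on \<^typ>\<open>'c mpol fps\<close> used by \<^const>\<open>suminf\<close> and \<^const>\<open>infsum\<close> is the \<open>Z\<close>-adic one, see
  \<open>dist_fps_def\<close>.
\<close>

definition exp_C ::
    "('q::finite_field fls alg_closure \<Rightarrow> 'c::field) \<Rightarrow> 'c mpol fps \<Rightarrow> 'c mpol fps" where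
  "exp_C emb G =
     suminf (\<lambda>i. fps_const (mconst (inverse (A_emb emb (carlitz_D i :: 'q poly)))) * G ^ (CARD('q) ^ i))"

definition frakL ::
    "('q::finite_field fls alg_closure \<Rightarrow> 'c::field) \<Rightarrow> 'c mpol \<Rightarrow> 'c mpol fps" where
  "frakL emb F = exp_C emb
     (infsum (\<lambda>a. fps_const (mconst (inverse (A_emb emb a))) * star emb a (fps_const F * fps_X))
        A_plus)"

text \<open>
  Convergence: the sums in \<^const>\<open>exp_C\<close> and \<^const>\<open>frakL\<close> are not default values, and the inner sum of
  \<^const>\<open>frakL\<close> is \<open>\<Sum>\<^sub>d Z\<^bsup>q^d\<^esup> \<Sum>\<^bsub>a \<in> A\<^sub>+, deg a = d\<^esub> F(C\<^sub>a(X\<^sub>1), \<dots>, C\<^sub>a(X\<^sub>s)) / a\<close>.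
\<close>

lemma CARD_finite_field_gt_1: "CARD('q::finite_field) > 1"
  using card_mono[of "UNIV :: 'q set" "{0, 1}"] by simp

lemma exp_C_sums:
  assumes "fps_nth G 0 = 0"
  shows "(\<lambda>i. fps_const (mconst (inverse (A_emb emb (carlitz_D i :: 'q::finite_field poly)))) * G ^ (CARD('q) ^ i))
           sums exp_C emb G"
proof -
  let ?f = "\<lambda>i. fps_const (mconst (inverse (A_emb emb (carlitz_D i :: 'q poly)))) * G ^ (CARD('q) ^ i)"
  have z: "fps_nth (?f i) n = 0" if "n < i" for i n
  proof -
    have "i < CARD('q) ^ i" using CARD_finite_field_gt_1[where ?'q = 'q] by (simp add: power_gt_expt)
    with that have "n < CARD('q) ^ i" by simp
    hence "fps_nth (G ^ (CARD('q) ^ i)) n = 0" using assms startsby_zero_power_prefix by blast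
    thus ?thesis by simp
  qed
  have "?f sums Abs_fps (\<lambda>n. \<Sum>i\<le>n. fps_nth (?f i) n)"
    unfolding sums_def
  proof (rule tendsto_fpsI)
    fix n
    show "eventually (\<lambda>N. fps_nth (\<Sum>i<N. ?f i) n = fps_nth (Abs_fps (\<lambda>n. \<Sum>i\<le>n. fps_nth (?f i) n)) n)
            sequentially"
      using eventually_gt_at_top[of n]
    proof eventually_elim
      case (elim N)
      have "(\<Sum>i<N. fps_nth (?f i) n) = (\<Sum>i\<le>n. fps_nth (?f i) n)"
        by (rule sum.mono_neutral_right) (use elim z in auto)
      thus ?case by (simp add: fps_sum_nth)
    qed
  qed
  thus ?thesis unfolding exp_C_def by (simp add: sums_iff)
qed

lemma star_FZ:
  fixes emb :: "'q::finite_field fls alg_closure \<Rightarrow> 'c::field"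
  shows "star emb a (fps_const F * fps_X) =
     fps_const (msubst (\<lambda>i. carlitz_at emb a (mvar i)) F) * fps_X ^ (CARD('q) ^ degree a)"
proof -
  let ?g = "\<lambda>p. msubst (\<lambda>i. carlitz_at emb a (mvar i)) p"
  have "Abs_fps (\<lambda>n. ?g (fps_nth (fps_const F * fps_X) n)) = fps_const (?g F) * fps_X"
    by (rule fps_ext) (auto simp: msubst_def fps_X_def)
  moreover have "fps_nth (fps_X ^ (CARD('q) ^ degree a) :: 'c mpol fps) 0 = 0"
    by simp
  ultimately show ?thesis
    by (simp add: star_def fps_compose_mult_distrib)
qed

lemma finite_A_plus_degree: "finite {a :: 'q::finite_field poly. a \<in> A_plus \<and> degree a = d}"
proof (rule finite_subset)
  show "{a :: 'q poly. a \<in> A_plus \<and> degree a = d} \<subseteq> Poly ` {xs. set xs \<subseteq> UNIV \<and> length xs \<le> Suc d}"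
  proof
    fix a :: "'q poly" assume "a \<in> {a. a \<in> A_plus \<and> degree a = d}"
    hence "length (coeffs a) \<le> Suc d" by (cases "coeffs a = []", simp, auto simp: length_coeffs_degree)
    thus "a \<in> Poly ` {xs. set xs \<subseteq> UNIV \<and> length xs \<le> Suc d}"
      by (intro image_eqI[of _ _ "coeffs a"]) auto
  qed
  show "finite (Poly ` {xs :: 'q list. set xs \<subseteq> UNIV \<and> length xs \<le> Suc d})"
    by (intro finite_imageI finite_lists_length_le) simp
qed

lemma star_FZ_has_sum:
  fixes emb :: "'q::finite_field fls alg_closure \<Rightarrow> 'c::field"
  defines "f \<equiv> \<lambda>F a. mconst (inverse (A_emb emb a)) * msubst (\<lambda>i. carlitz_at emb a (mvar i)) F"
  shows "((\<lambda>a. fps_const (mconst (inverse (A_emb emb a))) * star emb a (fps_const F * fps_X)) has_sum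
          suminf (\<lambda>d. fps_const (\<Sum>a | a \<in> A_plus \<and> degree a = d. f F a) * fps_X ^ (CARD('q) ^ d))) A_plus"
proof -
  let ?t = "\<lambda>a. fps_const (mconst (inverse (A_emb emb a))) * star emb a (fps_const F * fps_X)"
  let ?g = "\<lambda>d. fps_const (\<Sum>a | a \<in> A_plus \<and> degree a = d. f F a) * fps_X ^ (CARD('q) ^ d) :: 'c mpol fps"
  have t: "?t a = fps_const (f F a) * fps_X ^ (CARD('q) ^ degree a)" for a
    by (simp add: star_FZ f_def mult.assoc flip: fps_const_mult)
  have nth: "fps_nth (fps_const c * fps_X ^ k) n = (if n = k then c else 0)" for c :: "'c mpol" and k n
    by (simp add: fps_X_power_nth)
  have gt: "d < CARD('q) ^ d" for d using CARD_finite_field_gt_1[where ?'q = 'q] by (simp add: power_gt_expt)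
  define S where "S = Abs_fps (\<lambda>n. \<Sum>d\<le>n. fps_nth (?g d) n)"
  have "?g sums S"
    unfolding sums_def
  proof (rule tendsto_fpsI)
    fix n
    show "eventually (\<lambda>N. fps_nth (\<Sum>d<N. ?g d) n = fps_nth S n) sequentially"
      using eventually_gt_at_top[of n]
    proof eventually_elim
      case (elim N)
      have "(\<Sum>d<N. fps_nth (?g d) n) = (\<Sum>d\<le>n. fps_nth (?g d) n)"
        by (rule sum.mono_neutral_right) (use elim less_imp_le[OF gt] in \<open>auto simp: nth\<close>)
      thus ?case by (simp add: fps_sum_nth S_def)
    qed
  qed
  hence S: "suminf ?g = S" by (simp add: sums_iff)
  have "(?t has_sum S) A_plus"
    unfolding has_sum_def
  proof (rule tendsto_fpsI)
    fix n
    let ?B = "\<Union>d\<le>n. {a \<in> A_plus. degree a = d} :: 'q poly set"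
    have B: "finite ?B" "?B \<subseteq> A_plus" using finite_A_plus_degree by auto
    show "eventually (\<lambda>Y. fps_nth (sum ?t Y) n = fps_nth S n) (finite_subsets_at_top A_plus)"
      unfolding eventually_finite_subsets_at_top
    proof (intro exI[of _ ?B] conjI allI impI B)
      fix Y assume Y: "finite Y \<and> ?B \<subseteq> Y \<and> Y \<subseteq> A_plus"
      have "fps_nth (sum ?t Y) n = (\<Sum>a\<in>Y. fps_nth (?t a) n)" by (simp add: fps_sum_nth)
      also have "\<dots> = (\<Sum>a\<in>?B. fps_nth (?t a) n)"
      proof (rule sum.mono_neutral_right)
        show "\<forall>a\<in>Y - ?B. fps_nth (?t a) n = 0"
        proof
          fix a assume "a \<in> Y - ?B"
          hence "n < degree a" using Y by force
          hence "n \<noteq> CARD('q) ^ degree a" using gt[of "degree a"] by simp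
          thus "fps_nth (?t a) n = 0" unfolding t nth by simp
        qed
      qed (use Y in auto)
      also have "\<dots> = (\<Sum>d\<le>n. \<Sum>a\<in>{a \<in> A_plus. degree a = d}. fps_nth (?t a) n)"
        by (rule sum.UNION_disjoint) (use finite_A_plus_degree in auto)
      also have "\<dots> = fps_nth S n"
        unfolding S_def fps_nth_Abs_fps t nth by (intro sum.cong refl) auto
      finally show "fps_nth (sum ?t Y) n = fps_nth S n" .
    qed
  qed
  thus ?thesis using S by simp
qed

lemma frakL_altdef:
  fixes emb :: "'q::finite_field fls alg_closure \<Rightarrow> 'c::field"
  shows "frakL emb F = exp_C emb (suminf (\<lambda>d.
           fps_const (\<Sum>a | a \<in> A_plus \<and> degree a = d.
             mconst (inverse (A_emb emb a)) * msubst (\<lambda>i. carlitz_at emb a (mvar i)) F)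
           * fps_X ^ (CARD('q) ^ d)))"
  unfolding frakL_def infsumI[OF star_FZ_has_sum] ..

end

theory Submission
  imports Defs
begin

text \<open>
  The idea is to move the whole problem from \<open>\<bbbC>\<^sub>\<infinity>[X\<^sub>1,\<dots>,X\<^sub>s]\<close> to a polynomial ring in new variables
  \<open>t\<^sub>0,\<dots>,t\<^bsub>k-1\<^esub>\<close>, where the sums over monic polynomials become small at the infinite place.

  Write a monomial of \<open>F\<close> as \<open>c Y\<^sub>0 \<dots> Y\<^bsub>k-1\<^esub>\<close>, where each \<open>Y\<^sub>j\<close> is one of the \<open>X\<^sub>i\<close>. Let \<open>\<Psi>\<close> be the linear map
  that sends \<open>t\<^sub>0\<^sup>e \<dots> t\<^bsub>k-1\<^esub>\<^sup>e\<^sup>'\<close> to \<open>C\<^bsub>\<theta>^e\<^esub>(Y\<^sub>0) \<dots> C\<^bsub>\<theta>^e'\<^esub>(Y\<^bsub>k-1\<^esub>)\<close> (\<open>slot_eval\<close> with \<open>carlitz_slot\<close>). It sends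
  \<open>\<Prod>\<^sub>j a(t\<^sub>j)\<close> to \<open>\<Prod>\<^sub>j C\<^sub>a(Y\<^sub>j)\<close>, and because \<open>C\<^bsub>\<theta>^(e+1)\<^esub>(Y) - \<theta> C\<^bsub>\<theta>^e\<^esub>(Y) = C\<^bsub>\<theta>^e\<^esub>(Y)\<^sup>q\<close> it turns the operator
  \<open>\<phi>(f) = \<Prod>\<^sub>j (t\<^sub>j - \<theta>) \<cdot> \<tau>(f)\<close>, with \<open>\<tau>\<close> the \<open>q\<close>-th power on coefficients, into the \<open>q\<close>-th power map
  (\<open>slot_eval_phi\<close>). Hence the coefficient of \<open>Z\<^bsup>q^n\<^esup>\<close> in \<open>L(F, Z)\<close> is a sum of terms \<open>\<Psi>(E\<^sub>n)\<close>, with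
  \<open>E\<^sub>n = \<Sum>\<^bsub>i \<le> n\<^esub> \<phi>\<^sup>i(S\<^bsub>n-i\<^esub>) / D\<^sub>i\<close> and \<open>S\<^sub>d = \<Sum> c a(t\<^sub>0) \<dots> a(t\<^bsub>k-1\<^esub>) / a\<close>, summed over the monic \<open>a\<close> of
  degree \<open>d\<close>. As \<open>\<Psi>\<close> preserves coefficients in \<open>A\<close>, two facts about \<open>E\<^sub>n\<close> suffice.

  \<^item> \<open>E\<^sub>n\<close> has coefficients in \<open>A\<close> (\<open>log_alg_coeff_in_A\<close>). This is checked at one monic prime \<open>P\<close> at a time,
    by a Dwork-type argument. Splitting off the \<open>a\<close> divisible by \<open>P\<close> gives
    \<open>P S\<^sub>n = P H\<^sub>n + P(t\<^sub>0) \<dots> P(t\<^bsub>k-1\<^esub>) S\<^bsub>n-d\<^esub>\<close> with \<open>d = deg P\<close> and \<open>H\<^sub>n\<close> integral at \<open>P\<close>. The functional equation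
    \<open>exp\<^sub>C(P G) = C\<^sub>P(exp\<^sub>C(G))\<close> turns this into a recursion that expresses \<open>P E\<^sub>n\<close> by earlier \<open>E\<^sub>m\<close>.
    Its right-hand side vanishes modulo \<open>P\<close>, since \<open>C\<^sub>P\<close> reduces to the \<open>q\<^sup>d\<close>-th power map,
    \<open>\<phi>\<^sup>d(f)\<close> is congruent to \<open>P(t\<^sub>0) \<dots> P(t\<^bsub>k-1\<^esub>) f\<close>, and \<open>P\<^bsup>q^i\<^esup> / D\<^sub>i\<close> is divisible by \<open>P\<close>.

  \<^item> \<open>E\<^sub>n = 0\<close> for \<open>n > k + deg c\<close> (\<open>log_alg_coeff_eq_0\<close>). The coefficients of \<open>S\<^sub>d\<close> have absolute value at
    most \<open>q\<^bsup>deg c - d\<^esup>\<close>, because \<open>a(t)\<close> has constant coefficients. Together with \<open>|D\<^sub>i| = q\<^bsup>i q^i\<^esup>\<close> this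
    bounds those of \<open>E\<^sub>n\<close> by a number below 1, and \<open>0\<close> is the only element of \<open>A\<close> that small.
\<close>

section \<open>The Frobenius map\<close>

lemma add_power_card_power:
  fixes x y :: "'r::comm_ring_1"
  assumes "CHAR('r) = CHAR('q::finite_field)"
  shows "(x + y) ^ (CARD('q) ^ i) = x ^ (CARD('q) ^ i) + y ^ (CARD('q) ^ i)"
proof (induction i)
  case (Suc i)
  have "(x + y) ^ (CARD('q) ^ Suc i) = ((x + y) ^ (CARD('q) ^ i)) ^ CARD('q)"
    by (simp add: mult.commute flip: power_mult)
  also have "\<dots> = (x ^ (CARD('q) ^ i)) ^ CARD('q) + (y ^ (CARD('q) ^ i)) ^ CARD('q)"
    unfolding Suc.IH by (rule add_power_card[OF assms])
  finally show ?case by (simp add: mult.commute flip: power_mult)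
qed simp

lemma sum_power_card_power:
  fixes f :: "'i \<Rightarrow> 'r::comm_ring_1"
  assumes "CHAR('r) = CHAR('q::finite_field)"
  shows "sum f S ^ (CARD('q) ^ i) = (\<Sum>x\<in>S. f x ^ (CARD('q) ^ i))"
  by (induction S rule: infinite_finite_induct)
     (simp_all add: add_power_card_power[OF assms] zero_power)

lemma sum_power_card:
  fixes f :: "'i \<Rightarrow> 'r::comm_ring_1"
  assumes "CHAR('r) = CHAR('q::finite_field)"
  shows "sum f S ^ CARD('q) = (\<Sum>x\<in>S. f x ^ CARD('q))"
  using sum_power_card_power[OF assms, of f S 1] by simp

lemma diff_power_card_power:
  fixes x y :: "'r::comm_ring_1"
  assumes "CHAR('r) = CHAR('q::finite_field)"
  shows "(x - y) ^ (CARD('q) ^ i) = x ^ (CARD('q) ^ i) - y ^ (CARD('q) ^ i)"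
  using add_power_card_power[OF assms, of "x - y" y i] by (simp add: algebra_simps)

lemma diff_power_card:
  fixes x y :: "'r::comm_ring_1"
  assumes "CHAR('r) = CHAR('q::finite_field)"
  shows "(x - y) ^ CARD('q) = x ^ CARD('q) - y ^ CARD('q)"
  using diff_power_card_power[OF assms, of x y 1] by simp

lemma pCons_eq_const_plus_theta: "pCons c a = [:c:] + [:0, 1:] * (a :: 'a::comm_ring_1 poly)"
  by simp

lemma const_poly_power_card_power:
  "[:c::'q::finite_field:] ^ (CARD('q) ^ i) = [:c:]"
  by (simp add: poly_const_pow finite_field_power_card_power_eq_same)

lemma const_poly_power_card:
  "[:c::'q::finite_field:] ^ CARD('q) = [:c:]"
  using const_poly_power_card_power[of c 1] by simp

section \<open>Coefficients of the Carlitz module and Carlitz factorials\<close>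

text \<open>
  As \<open>C\<^sub>a\<close> is \<open>\<bbbF>\<^sub>q\<close>-linear, the exponents
  \<open>q\<^sup>j\<close> are the only ones that occur in it. Below, \<open>[a, j]\<close>
  stands for \<open>carlitz_coeff a j\<close>.
\<close>

definition carlitz_coeff :: "'q::finite_field poly \<Rightarrow> nat \<Rightarrow> 'q poly" where
  "carlitz_coeff a j = coeff (carlitz a) (CARD('q) ^ j)"

lemma coeff_power_card:
  fixes f :: "'q::finite_field poly poly"
  shows "coeff (f ^ CARD('q)) n = (if CARD('q) dvd n then coeff f (n div CARD('q)) ^ CARD('q) else 0)"
proof (induction f arbitrary: n)
  case 0
  thus ?case by (simp add: zero_power)
next
  case (pCons a g)
  let ?q = "CARD('q)"
  have q: "?q > 1" by (rule CARD_finite_field_gt_1)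
  have "pCons a g = [:a:] + monom 1 1 * g" by (simp add: monom_Suc monom_0)
  hence "pCons a g ^ ?q = [:a ^ ?q:] + monom 1 ?q * g ^ ?q"
    by (simp only: add_power_card[where ?'q='q and ?'r = "'q poly poly"] semiring_char_poly
          power_mult_distrib monom_power poly_const_pow) simp
  hence "coeff (pCons a g ^ ?q) n =
           (if n = 0 then a ^ ?q else 0) + (if n < ?q then 0 else coeff (g ^ ?q) (n - ?q))"
    by (simp add: coeff_monom_mult coeff_pCons split: nat.split)
  also have "\<dots> = (if ?q dvd n then coeff (pCons a g) (n div ?q) ^ ?q else 0)"
  proof (cases "n < ?q")
    case True
    thus ?thesis using q by (auto simp: zero_power dest: dvd_imp_le)
  next
    case False
    then obtain m where m: "n = ?q + m" by (auto simp: not_less le_iff_add)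
    show ?thesis using q by (simp add: m pCons.IH)
  qed
  finally show ?case .
qed

lemma carlitz_coeff_zero [simp]: "carlitz_coeff 0 j = 0"
  by (simp add: carlitz_coeff_def carlitz_const[of 0, simplified])

lemma carlitz_coeff_pCons:
  fixes a :: "'q::finite_field poly"
  shows "carlitz_coeff (pCons c a) j = (if j = 0 then [:c:] else 0) + [:0, 1:] * carlitz_coeff a j
           + (if j = 0 then 0 else carlitz_coeff a (j - 1) ^ CARD('q))"
proof -
  let ?q = "CARD('q)"
  have q: "?q > 1" by (rule CARD_finite_field_gt_1)
  have "coeff [:0, [:c:]:] (?q ^ j) = (if j = 0 then [:c:] else 0)"
    using q by (cases j) (auto simp: coeff_pCons split: nat.split)
  moreover have "coeff (carlitz a ^ ?q) (?q ^ j) = (if j = 0 then 0 else carlitz_coeff a (j - 1) ^ ?q)"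
    using q by (cases j) (auto simp: coeff_power_card carlitz_coeff_def)
  ultimately show ?thesis
    by (simp add: carlitz_coeff_def carlitz_pCons pcompose_carlitz_theta)
qed

lemma carlitz_coeff_0_right [simp]: "carlitz_coeff a 0 = a"
  by (induction a) (simp_all add: carlitz_coeff_pCons)

lemma carlitz_coeff_eq_0: "degree a < j \<Longrightarrow> carlitz_coeff a j = 0"
proof (induction a arbitrary: j)
  case (pCons c a)
  thus ?case using CARD_finite_field_gt_1[where ?'q='a]
    by (cases "a = 0") (auto simp: carlitz_coeff_pCons zero_power)
qed simp

lemma carlitz_coeff_degree: "carlitz_coeff a (degree a) = [:lead_coeff a:]"
proof (induction a)
  case (pCons c a)
  show ?case
  proof (cases "a = 0")
    case True
    thus ?thesis by simp
  next
    case False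
    thus ?thesis
      by (simp add: carlitz_coeff_pCons carlitz_coeff_eq_0 pCons.IH const_poly_power_card)
  qed
qed simp

text \<open>
  Comparing coefficients in \<open>C\<^sub>a C\<^sub>\<theta> = C\<^sub>\<theta>
  C\<^sub>a\<close> yields this recursion. It starts at \<open>[a, 0] = a\<close>, so that it
  carries divisibility by a prime \<open>P\<close> from \<open>[P, 0]\<close> upwards. The
  proof follows the Horner scheme for \<open>a\<close>.
\<close>

lemma carlitz_coeff_rec:
  fixes a :: "'q::finite_field poly"
  shows "([:0, 1:] ^ (CARD('q) ^ Suc j) - [:0, 1:]) * carlitz_coeff a (Suc j)
           = carlitz_coeff a j ^ CARD('q) - carlitz_coeff a j"
proof (induction a arbitrary: j)
  case 0
  thus ?case by (simp add: zero_power)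
next
  case (pCons c a)
  let ?q = "CARD('q)" and ?t = "[:0, 1:] :: 'q poly"
  let ?u = "carlitz_coeff a (Suc j)" and ?v = "carlitz_coeff a j"
  \<comment> \<open>the part of \<open>[c + \<theta> a, j]\<close> that does not come from \<open>\<theta> [a, j]\<close>\<close>
  define w where "w = (if j = 0 then [:c:] else carlitz_coeff a (j - 1) ^ ?q)"
  have v: "carlitz_coeff (pCons c a) j = ?t * ?v + w"
    by (simp add: carlitz_coeff_pCons w_def)
  have u: "carlitz_coeff (pCons c a) (Suc j) = ?t * ?u + ?v ^ ?q"
    by (simp add: carlitz_coeff_pCons)
  have w: "w ^ ?q - w = (?t ^ (?q ^ Suc j) - ?t ^ ?q) * ?v ^ ?q"
  proof (cases j)
    case 0
    thus ?thesis by (simp add: w_def const_poly_power_card)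
  next
    case (Suc i)
    have "w ^ ?q - w = (carlitz_coeff a i ^ ?q - carlitz_coeff a i) ^ ?q"
      using Suc by (simp add: w_def diff_power_card[where ?'q='q])
    also have "\<dots> = ((?t ^ (?q ^ j) - ?t) * ?v) ^ ?q"
      using pCons.IH[of i] by (simp add: Suc)
    also have "\<dots> = (?t ^ (?q ^ Suc j) - ?t ^ ?q) * ?v ^ ?q"
      unfolding power_mult_distrib diff_power_card[where ?'q='q and ?'r="'q poly", OF semiring_char_poly]
      by (simp only: power_mult[symmetric] power_Suc2[symmetric])
    finally show ?thesis .
  qed
  have "carlitz_coeff (pCons c a) j ^ ?q - carlitz_coeff (pCons c a) j
          = ?t ^ ?q * ?v ^ ?q - ?t * ?v + (w ^ ?q - w)"
    unfolding v add_power_card[where ?'q='q and ?'r="'q poly", OF semiring_char_poly] power_mult_distrib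
    by (simp only: algebra_simps)
  also have "\<dots> = ?t ^ (?q ^ Suc j) * ?v ^ ?q - ?t * ?v"
    unfolding w by (simp add: algebra_simps)
  also have "\<dots> = ?t * (?v ^ ?q - ?v) + (?t ^ (?q ^ Suc j) - ?t) * ?v ^ ?q"
    by (simp add: algebra_simps)
  also have "\<dots> = (?t ^ (?q ^ Suc j) - ?t) * (?t * ?u + ?v ^ ?q)"
    unfolding pCons.IH[of j, symmetric] by (simp only: algebra_simps)
  finally show ?case unfolding u by simp
qed

text \<open>
  A polynomial over the domain \<open>R/(P)\<close> has at most as many roots as its degree.
  The statement is phrased with representatives, so that the quotient need not be formed.
\<close>

lemma prime_dvd_lead_coeff_if_many_roots:
  fixes P :: "'a::idom"
  assumes P: "prime_elem P"
    and "finite S" "\<And>x y. x \<in> S \<Longrightarrow> y \<in> S \<Longrightarrow> x \<noteq> y \<Longrightarrow> \<not> P dvd (x - y)"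
    and "\<And>x. x \<in> S \<Longrightarrow> P dvd poly f x" "card S > degree f"
  shows "P dvd lead_coeff f"
  using assms(2-)
proof (induction "degree f" arbitrary: f S)
  case 0
  then obtain x where "x \<in> S" by (cases "S = {}") auto
  moreover obtain c where "f = [:c:]" using 0(1) by (metis degree_0_id)
  ultimately show ?case using 0(4) by force
next
  case (Suc n)
  from Suc.prems(4) obtain r where r: "r \<in> S" by (cases "S = {}") auto
  define g where "g = synthetic_div f r"
  have f: "[:-r, 1:] * g + [:poly f r:] = f" unfolding g_def by (rule synthetic_div_correct')
  have dg: "degree g = n" using Suc(2) by (simp add: g_def degree_synthetic_div)
  have lead: "lead_coeff g = lead_coeff f"
  proof -
    have "coeff f (Suc n) = coeff ([:-r, 1:] * g + [:poly f r:]) (Suc n)" by (simp only: f)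
    also have "\<dots> = coeff g n" using dg by (simp add: coeff_eq_0)
    finally show ?thesis using dg Suc(2) by simp
  qed
  have "P dvd lead_coeff g"
  proof (rule Suc.hyps(1)[of g "S - {r}"])
    fix s assume s: "s \<in> S - {r}"
    have "(s - r) * poly g s + poly f r = poly ([:-r, 1:] * g + [:poly f r:]) s"
      by (simp add: algebra_simps)
    also have "\<dots> = poly f s" by (simp only: f)
    finally have "(s - r) * poly g s = poly f s - poly f r" by (simp add: algebra_simps)
    hence "P dvd (s - r) * poly g s" using Suc.prems(3) s r by (metis DiffD1 dvd_diff)
    thus "P dvd poly g s" using P Suc.prems(2)[of s r] s r by (auto simp: prime_elem_dvd_mult_iff)
  qed (use Suc dg r in auto)
  thus ?case using lead by simp
qed

lemma card_poly_degree_less: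
  assumes "d > 0"
  shows "finite {a :: 'q::finite_field poly. degree a < d}"
    and "card {a :: 'q poly. degree a < d} = CARD('q) ^ d"
proof -
  let ?L = "{xs :: 'q list. set xs \<subseteq> UNIV \<and> length xs = d}"
  have bij: "bij_betw Poly ?L {a :: 'q poly. degree a < d}"
  proof (rule bij_betwI')
    fix xs ys :: "'q list" assume "xs \<in> ?L" "ys \<in> ?L"
    moreover have "xs = ys" if "Poly xs = Poly ys" "length xs = d" "length ys = d"
    proof (rule nth_equalityI)
      fix i assume "i < length xs"
      thus "xs ! i = ys ! i"
        using arg_cong[OF that(1), of "\<lambda>p. coeff p i"] that(2,3) by (simp add: nth_default_nth)
    qed (use that in simp)
    ultimately show "Poly xs = Poly ys \<longleftrightarrow> xs = ys" by auto
  next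
    fix xs :: "'q list" assume "xs \<in> ?L"
    hence "degree (Poly xs) \<le> d - 1" by (intro degree_le) (auto simp: nth_default_def)
    thus "Poly xs \<in> {a. degree a < d}" using assms by simp
  next
    fix a :: "'q poly" assume a: "a \<in> {a. degree a < d}"
    have "a = Poly (map (coeff a) [0..<d])"
      using a by (intro poly_eqI) (auto simp: nth_default_def coeff_eq_0)
    thus "\<exists>xs\<in>?L. a = Poly xs" by (intro bexI[of _ "map (coeff a) [0..<d]"]) auto
  qed
  have "finite ?L" by (rule finite_lists_length_eq) simp
  thus "finite {a :: 'q poly. degree a < d}" using bij_betw_finite[OF bij] by blast
  show "card {a :: 'q poly. degree a < d} = CARD('q) ^ d"
    using bij_betw_same_card[OF bij] card_lists_length_eq[of "UNIV :: 'q set" d] by simp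
qed

text \<open>
  Modulo \<open>P\<close>, the \<open>q\<^sup>i\<close>-th power map is an
  \<open>\<bbbF>\<^sub>q\<close>-algebra endomorphism, hence the identity as soon as it fixes
  \<open>\<theta>\<close>.
\<close>

lemma dvd_power_card_power_minus_self:
  fixes P a :: "'q::finite_field poly"
  assumes "P dvd [:0, 1:] ^ (CARD('q) ^ i) - [:0, 1:]"
  shows "P dvd a ^ (CARD('q) ^ i) - a"
proof (induction a)
  case 0
  thus ?case by (simp add: zero_power)
next
  case (pCons c a)
  let ?Q = "CARD('q) ^ i" and ?t = "[:0, 1:] :: 'q poly"
  have "pCons c a ^ ?Q - pCons c a = (?t ^ ?Q - ?t) * a ^ ?Q + ?t * (a ^ ?Q - a)"
    unfolding pCons_eq_const_plus_theta[of c a] add_power_card_power[where ?'q='q and ?'r="'q poly", OF semiring_char_poly]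
      power_mult_distrib const_poly_power_card_power
    by (simp only: algebra_simps)
  also have "P dvd \<dots>" using assms pCons.IH by (intro dvd_add dvd_mult dvd_mult2)
  finally show ?case .
qed

text \<open>
  Otherwise all \<open>q\<^bsup>deg P\<^esup>\<close> residues modulo \<open>P\<close> would be
  roots of \<open>Y\<^bsup>q^i\<^esup> - Y\<close>, whose degree is smaller.
\<close>

lemma not_dvd_theta_power_card_power_minus_theta:
  fixes P :: "'q::finite_field poly"
  assumes P: "prime_elem P" and i: "0 < i" "i < degree P"
  shows "\<not> P dvd [:0, 1:] ^ (CARD('q) ^ i) - [:0, 1:]"
proof
  assume *: "P dvd [:0, 1:] ^ (CARD('q) ^ i) - [:0, 1:]"
  let ?q = "CARD('q)" and ?S = "{a :: 'q poly. degree a < degree P}"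
  have q: "?q > 1" by (rule CARD_finite_field_gt_1)
  \<comment> \<open>the polynomial \<open>Y\<^bsup>q^i\<^esup> - Y\<close>, monic of degree \<open>q\<^sup>i\<close> because \<open>i > 0\<close>\<close>
  define f :: "'q poly poly" where "f = monom 1 (?q ^ i) - monom 1 1"
  have gt: "?q ^ i > 1" using q i(1) by (intro one_less_power)
  have cf: "coeff f (?q ^ i) = 1" using gt by (simp add: f_def)
  have df: "degree f = ?q ^ i"
  proof (rule antisym)
    show "degree f \<le> ?q ^ i" using gt unfolding f_def
      by (intro degree_diff_le) (auto intro: order.trans[OF degree_monom_le])
    show "?q ^ i \<le> degree f" using cf by (intro le_degree) simp
  qed
  have "P dvd lead_coeff f"
  proof (rule prime_dvd_lead_coeff_if_many_roots[OF P, of ?S])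
    show "\<not> P dvd x - y" if "x \<in> ?S" "y \<in> ?S" "x \<noteq> y" for x y
    proof -
      have "degree (x - y) < degree P" using that by (intro degree_diff_less) auto
      thus ?thesis using that(3) dvd_imp_degree_le[of P "x - y"] by auto
    qed
    show "P dvd poly f x" for x
      using dvd_power_card_power_minus_self[OF *, of x] by (simp only: f_def poly_monom poly_diff mult_1_left power_one_right)
    show "degree f < card ?S"
    proof -
      have "card ?S = ?q ^ degree P" by (rule card_poly_degree_less(2)) (use i in simp)
      moreover have "?q ^ i < ?q ^ degree P" by (rule power_strict_increasing) (use i q in auto)
      ultimately show ?thesis by (simp only: df)
    qed
    show "finite ?S" by (rule card_poly_degree_less(1)) (use i in simp)
  qed
  hence "P dvd 1" by (simp only: df cf)
  thus False using prime_elem_not_unit[OF P] by blast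
qed

lemma dvd_power_card_minus_self:
  fixes P x :: "'q::finite_field poly"
  assumes "P dvd x"
  shows "P dvd x ^ CARD('q) - x"
proof (rule dvd_diff[OF _ assms])
  have "x dvd x ^ CARD('q)" by (rule dvd_power) simp
  with assms show "P dvd x ^ CARD('q)" by (rule dvd_trans)
qed

text \<open>
  For \<open>0 < j < deg P\<close> the factor \<open>\<theta>\<^bsup>q^j\<^esup> -
  \<theta>\<close> in the recursion is a unit modulo \<open>P\<close>, so divisibility passes
  from \<open>[P, j - 1]\<close> to \<open>[P, j]\<close>. As \<open>[P, deg P] = 1\<close> for
  monic \<open>P\<close>, this says that \<open>C\<^sub>P\<close> reduces to
  \<open>X\<^bsup>q^deg P\<^esup>\<close> modulo \<open>P\<close>.
\<close>

lemma prime_dvd_carlitz_coeff: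
  assumes P: "prime_elem P" and "j < degree P"
  shows "P dvd carlitz_coeff P j"
  using assms(2)
proof (induction j)
  case (Suc j)
  have "P dvd carlitz_coeff P j ^ CARD('a) - carlitz_coeff P j"
    using Suc by (intro dvd_power_card_minus_self) simp
  hence "P dvd ([:0, 1:] ^ (CARD('a) ^ Suc j) - [:0, 1:]) * carlitz_coeff P (Suc j)"
    by (simp only: carlitz_coeff_rec)
  moreover have "\<not> P dvd ([:0, 1:] ^ (CARD('a) ^ Suc j) - [:0, 1:])"
    by (rule not_dvd_theta_power_card_power_minus_theta[OF P zero_less_Suc Suc.prems])
  ultimately show ?case using prime_elem_dvd_multD[OF P] by blast
qed simp

text \<open>
  Fermat's little theorem for \<open>A/P\<close>. It drops out of the same recursion at
  \<open>j = deg P\<close>, where \<open>[P, j] = 1\<close> and the right-hand side is already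
  known to be divisible by \<open>P\<close>.
\<close>

lemma prime_dvd_power_card_power_degree_minus_self:
  fixes P a :: "'q::finite_field poly"
  assumes P: "prime_elem P" "lead_coeff P = 1" and d: "degree P > 0"
  shows "P dvd a ^ (CARD('q) ^ degree P) - a"
proof (rule dvd_power_card_power_minus_self)
  obtain j where j: "degree P = Suc j" using d by (cases "degree P") auto
  have "P dvd carlitz_coeff P j ^ CARD('q) - carlitz_coeff P j"
    using prime_dvd_carlitz_coeff[OF P(1), of j] j by (intro dvd_power_card_minus_self) simp
  hence "P dvd ([:0, 1:] ^ (CARD('q) ^ Suc j) - [:0, 1:]) * carlitz_coeff P (Suc j)"
    by (simp only: carlitz_coeff_rec)
  moreover have "carlitz_coeff P (Suc j) = 1"
    using carlitz_coeff_degree[of P] P(2) j by simp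
  ultimately show "P dvd [:0, 1:] ^ (CARD('q) ^ degree P) - [:0, 1:]" unfolding j by (simp only: mult_1_right)
qed

text \<open>
  In characteristic \<open>p\<close> the derivative of \<open>\<theta>\<^bsup>q^(i+1)\<^esup> -
  \<theta>\<close> is \<open>-1\<close>.
\<close>

lemma theta_power_card_power_minus_theta_squarefree:
  fixes P :: "'q::finite_field poly"
  assumes "\<not> is_unit P"
  shows "\<not> P ^ 2 dvd [:0, 1:] ^ (CARD('q) ^ Suc i) - [:0, 1:]"
proof
  define N where "N = CARD('q) ^ Suc i"
  assume "P ^ 2 dvd [:0, 1:] ^ (CARD('q) ^ Suc i) - [:0, 1:]"
  then obtain w where "[:0, 1:] ^ N - [:0, 1:] = P ^ 2 * w"
    unfolding N_def by (rule dvdE)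
  hence w: "[:0, 1:] ^ N - [:0, 1:] = P * (P * w)"
    by (simp only: power2_eq_square mult.assoc)
  have "(of_nat N :: 'q) = 0"
  proof -
    obtain n where "n > 0" "CARD('q) = CHAR('q) ^ n" using card_finite_field_prime_power by metis
    thus ?thesis by (simp add: N_def of_nat_eq_0_iff_char_dvd)
  qed
  hence "pderiv ([:0, 1:] ^ N - [:0, 1:] :: 'q poly) = - [:1:]"
    by (simp add: pderiv_diff pderiv_power pderiv_pCons)
  hence "pderiv ([:0, 1:] ^ N - [:0, 1:] :: 'q poly) = -1" by (simp only: one_pCons)
  hence "-1 = P * (pderiv (P * w) + w * pderiv P)"
    unfolding w by (simp only: pderiv_mult algebra_simps)
  hence "P dvd -1" by (rule dvdI)
  thus False using assms by simp
qed

lemma carlitz_D_nonzero: "carlitz_D i \<noteq> 0"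
proof (induction i)
  case (Suc i)
  have "\<not> [:0, 1:] ^ 2 dvd ([:0, 1:] ^ (CARD('a) ^ Suc i) - [:0, 1:] :: 'a poly)"
    by (rule theta_power_card_power_minus_theta_squarefree) (simp add: is_unit_pCons_iff)
  hence "[:0, 1:] ^ (CARD('a) ^ Suc i) - [:0, 1:] \<noteq> (0 :: 'a poly)" by force
  thus ?case using Suc by (simp del: power_Suc)
qed simp

lemma degree_carlitz_D: "degree (carlitz_D i :: 'q::finite_field poly) = i * CARD('q) ^ i"
proof (induction i)
  case (Suc i)
  let ?q = "CARD('q)"
  have gt: "?q ^ Suc i > 1" using CARD_finite_field_gt_1 by (intro one_less_power) auto
  have "degree ([:0, 1:] ^ (?q ^ Suc i) - [:0, 1:] :: 'q poly) = degree ([:0, 1:] ^ (?q ^ Suc i) :: 'q poly)"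
    unfolding diff_conv_add_uminus
    using gt by (intro degree_add_eq_left) (simp add: degree_power_eq)
  also have "\<dots> = ?q ^ Suc i" by (simp only: degree_linear_power)
  finally have "degree ([:0, 1:] ^ (?q ^ Suc i) - [:0, 1:] :: 'q poly) = ?q ^ Suc i" .
  moreover have "[:0, 1:] ^ (?q ^ Suc i) - [:0, 1:] \<noteq> (0 :: 'q poly)"
    using carlitz_D_nonzero[of "Suc i", where ?'a='q] by (metis carlitz_D.simps(2) mult_zero_left)
  ultimately have "degree (carlitz_D (Suc i) :: 'q poly) = ?q ^ Suc i + ?q * (i * ?q ^ i)"
    unfolding carlitz_D.simps by (subst degree_mult_eq) (simp_all add: carlitz_D_nonzero degree_power_eq Suc.IH)
  thus ?case by (simp add: algebra_simps)
qed simp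

text \<open>
  In terms of valuations: \<open>v\<^sub>P(D\<^sub>i) \<le> q\<^sup>i - 1\<close>. By
  squarefreeness \<open>v\<^sub>P(D\<^bsub>i+1\<^esub>) \<le> 1 + q
  v\<^sub>P(D\<^sub>i)\<close>, and \<open>1 + q (q\<^sup>i - 1) \<le> q\<^bsup>i+1\<^esup> -
  1\<close> as \<open>q \<ge> 2\<close>.
\<close>

lemma carlitz_D_dvd_prime_power:
  fixes P :: "'q::finite_field poly"
  assumes P: "prime_elem P"
  obtains a b where "\<not> P dvd b" "P ^ (CARD('q) ^ i - 1) * b = carlitz_D i * a"
proof -
  let ?q = "CARD('q)"
  have q: "?q > 1" by (rule CARD_finite_field_gt_1)
  have "\<exists>a b. \<not> P dvd b \<and> P ^ (?q ^ i - 1) * b = carlitz_D i * a"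
  proof (induction i)
    case 0
    have "\<not> P dvd 1" using P by (rule prime_elem_not_unit)
    thus ?case by (intro exI[of _ 1]) auto
  next
    case (Suc i)
    then obtain a b where ab: "\<not> P dvd b" "P ^ (?q ^ i - 1) * b = carlitz_D i * a" by blast
    define N :: "'q poly" where "N = [:0, 1:] ^ (?q ^ Suc i) - [:0, 1:]"
    have "\<exists>a' b'. \<not> P dvd b' \<and> P ^ (?q - 1) * b' = N * a'"
    proof (cases "P dvd N")
      case False
      thus ?thesis by (intro exI[of _ "P ^ (?q - 1)"] exI[of _ N]) auto
    next
      case True
      then obtain b' where b': "N = P * b'" by auto
      have "\<not> P ^ 2 dvd N" unfolding N_def
        using theta_power_card_power_minus_theta_squarefree prime_elem_not_unit[OF P] by blast
      hence "\<not> P dvd b'" by (auto simp: b' power2_eq_square)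
      moreover have "?q - 1 = Suc (?q - 2)" using q by simp
      ultimately show ?thesis
        by (intro exI[of _ "P ^ (?q - 2)"] exI[of _ b']) (auto simp: b')
    qed
    then obtain a' b' where ab': "\<not> P dvd b'" "P ^ (?q - 1) * b' = N * a'" by blast
    have ex: "?q ^ Suc i - 1 = (?q ^ i - 1) * ?q + (?q - 1)"
    proof -
      obtain m where "?q ^ i = Suc m" using q by (cases "?q ^ i") auto
      thus ?thesis using q by (simp add: algebra_simps)
    qed
    have "P ^ (?q ^ Suc i - 1) = (P ^ (?q ^ i - 1)) ^ ?q * P ^ (?q - 1)"
      by (simp only: ex power_add power_mult)
    hence "P ^ (?q ^ Suc i - 1) * (b ^ ?q * b') = (P ^ (?q ^ i - 1) * b) ^ ?q * (P ^ (?q - 1) * b')"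
      by (simp only: power_mult_distrib mult_ac)
    also have "\<dots> = carlitz_D (Suc i) * (a ^ ?q * a')"
      unfolding ab(2) ab'(2) by (simp only: carlitz_D.simps N_def power_mult_distrib mult_ac)
    finally show ?case using ab(1) ab'(1) P
      by (intro exI[of _ "a ^ ?q * a'"] exI[of _ "b ^ ?q * b'"])
         (auto simp: prime_elem_dvd_mult_iff dest: prime_elem_dvd_power)
  qed
  thus ?thesis using that by blast
qed

lemma obtain_monic_prime_divisor:
  fixes b :: "'a::field poly"
  assumes "degree b > 0"
  obtains P where "prime_elem P" "lead_coeff P = 1" "degree P > 0" "P dvd b"
proof -
  define P0 where "P0 = arg_min degree (\<lambda>P. degree P > 0 \<and> P dvd b)"
  have P0: "degree P0 > 0" "P0 dvd b"
    using arg_min_natI[of "\<lambda>P. degree P > 0 \<and> P dvd b" b degree] assms by (auto simp: P0_def)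
  have min: "degree P0 \<le> degree P" if "degree P > 0" "P dvd b" for P
    unfolding P0_def using that by (intro arg_min_nat_le) auto
  have nz: "P0 \<noteq> 0" using P0 by auto
  define P where "P = smult (inverse (lead_coeff P0)) P0"
  have dP: "degree P = degree P0" using nz by (simp add: P_def)
  have "Factorial_Ring.irreducible P"
  proof (rule Factorial_Ring.irreducibleI)
    show "P \<noteq> 0" using nz by (simp add: P_def)
    show "\<not> P dvd 1" using P0(1) dP by (metis is_unit_iff_degree \<open>P \<noteq> 0\<close> less_irrefl)
    fix x y assume xy: "P = x * y"
    hence "x \<noteq> 0" "y \<noteq> 0" using \<open>P \<noteq> 0\<close> by auto
    hence deg: "degree x + degree y = degree P0" using xy dP by (simp add: degree_mult_eq)
    have dv: "P dvd b" using P0(2) nz by (simp add: P_def smult_dvd_iff)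
    have "x dvd b" "y dvd b" using dv xy by (auto intro: dvd_trans)
    hence "degree x = 0 \<or> degree y = 0" using min[of x] min[of y] deg by linarith
    thus "x dvd 1 \<or> y dvd 1" using \<open>x \<noteq> 0\<close> \<open>y \<noteq> 0\<close> by (auto simp: is_unit_iff_degree)
  qed
  hence "prime_elem P" by (rule field_poly_irreducible_imp_prime)
  moreover have "lead_coeff P = 1" using nz by (simp add: P_def)
  moreover have "P dvd b" using P0(2) nz by (simp add: P_def smult_dvd_iff)
  ultimately show ?thesis using that P0(1) dP by simp
qed

section \<open>Coefficients of multivariate polynomials\<close>

lemma
  fixes h :: "'a::comm_ring_1 \<Rightarrow> 'b::comm_ring_1"
  assumes add: "\<And>x y. h (x + y) = h x + h y" and mult: "\<And>x y. h (x * y) = h x * h y"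
    and one: "h 1 = 1"
  shows poly_map_poly_hom_add: "poly (map_poly h (p + q)) t = poly (map_poly h p) t + poly (map_poly h q) t"
    and poly_map_poly_hom_smult: "poly (map_poly h (smult c p)) t = h c * poly (map_poly h p) t"
    and poly_map_poly_hom_mult: "poly (map_poly h (p * q)) t = poly (map_poly h p) t * poly (map_poly h q) t"
    and poly_map_poly_hom_power: "poly (map_poly h (p ^ n)) t = poly (map_poly h p) t ^ n"
proof -
  have h0: "h 0 = 0" using add[of 0 0] by simp
  show A: "poly (map_poly h (p + q)) t = poly (map_poly h p) t + poly (map_poly h q) t" for p q
    by (induction p q rule: poly_induct2) (simp_all add: map_poly_pCons h0 add algebra_simps)
  show S: "poly (map_poly h (smult c p)) t = h c * poly (map_poly h p) t" for c p
    by (induction p) (simp_all add: map_poly_pCons h0 mult algebra_simps)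
  show M: "poly (map_poly h (p * q)) t = poly (map_poly h p) t * poly (map_poly h q) t" for p q
    by (induction p) (simp_all add: map_poly_pCons h0 A S algebra_simps)
  show "poly (map_poly h (p ^ n)) t = poly (map_poly h p) t ^ n"
    by (induction n) (simp_all add: M one)
qed

lemma poly_mapping_sum_single: "p = (\<Sum>m\<in>Poly_Mapping.keys p. Poly_Mapping.single m (Poly_Mapping.lookup p m))"
proof (rule poly_mapping_eqI)
  fix k
  have "Poly_Mapping.lookup (\<Sum>m\<in>Poly_Mapping.keys p. Poly_Mapping.single m (Poly_Mapping.lookup p m)) k
          = (\<Sum>m\<in>Poly_Mapping.keys p. if m = k then Poly_Mapping.lookup p m else 0)"
    by (simp add: lookup_sum lookup_single when_def)
  thus "Poly_Mapping.lookup p k = Poly_Mapping.lookup (\<Sum>m\<in>Poly_Mapping.keys p. Poly_Mapping.single m (Poly_Mapping.lookup p m)) k"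
    by (simp add: in_keys_iff)
qed

lemma poly_mapping_single_add_induct [case_names single add]:
  fixes p :: "'a \<Rightarrow>\<^sub>0 'b::comm_monoid_add"
  assumes "\<And>m c. P (Poly_Mapping.single m c)" "\<And>p q. P p \<Longrightarrow> P q \<Longrightarrow> P (p + q)"
  shows "P p"
proof -
  have "P (\<Sum>m\<in>S. Poly_Mapping.single m (Poly_Mapping.lookup p m))" for S
    by (induction S rule: infinite_finite_induct) (use assms assms(1)[of _ 0] in auto)
  thus ?thesis using poly_mapping_sum_single[of p] by metis
qed

lemma mconst_add: "mconst (x + y) = mconst x + mconst y"
  by (simp add: mconst_def single_add)

lemma mconst_mult: "mconst (x * y) = mconst x * (mconst y :: 'c::semiring_0 mpol)"
  by (simp add: mconst_def mult_single)

lemma mconst_0 [simp]: "mconst 0 = 0" by (simp add: mconst_def)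

lemma mconst_1 [simp]: "mconst 1 = 1" by (simp add: mconst_def)

lemma mconst_power: "mconst (x ^ n) = (mconst x :: 'c::comm_semiring_1 mpol) ^ n"
  by (induction n) (simp_all add: mconst_mult)

lemma mconst_uminus: "mconst (- x) = - (mconst x :: 'c::ab_group_add mpol)"
  by (simp add: mconst_def single_uminus)

lemma lookup_mconst_mult: "Poly_Mapping.lookup (mconst c * p) m = (c :: 'c::semiring_0) * Poly_Mapping.lookup p m"
  unfolding mconst_def
  by (subst mult_map_scale_conv_mult[symmetric]) (simp add: map.rep_eq when_def)

lemma CHAR_mpol: "CHAR('c::comm_ring_1 mpol) = CHAR('c)"
proof (rule CHAR_eqI)
  have "of_nat n = (mconst (of_nat n) :: 'c mpol)" for n
    by (induction n) (simp_all add: mconst_add)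
  moreover have "mconst x = 0 \<longleftrightarrow> x = 0" for x :: 'c
    unfolding mconst_def by (metis lookup_single_eq single_zero)
  ultimately have *: "of_nat n = (0 :: 'c mpol) \<longleftrightarrow> of_nat n = (0 :: 'c)" for n by simp
  show "of_nat CHAR('c) = (0 :: 'c mpol)" by (simp add: *)
  show "CHAR('c) dvd n" if "of_nat n = (0 :: 'c mpol)" for n
    using that by (simp add: * of_nat_eq_0_iff_char_dvd)
qed

definition coeffs_in :: "'c::zero set \<Rightarrow> 'c mpol \<Rightarrow> bool" where
  "coeffs_in M p \<longleftrightarrow> (\<forall>m. Poly_Mapping.lookup p m \<in> M)"

lemma coeffs_in_add:
  assumes "\<And>x y. x \<in> M \<Longrightarrow> y \<in> M \<Longrightarrow> x + y \<in> M" "coeffs_in M p" "coeffs_in M r"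
  shows "coeffs_in M (p + r)"
  using assms by (simp add: coeffs_in_def lookup_add)

lemma coeffs_in_sum:
  assumes "0 \<in> M" "\<And>x y. x \<in> M \<Longrightarrow> y \<in> M \<Longrightarrow> x + y \<in> M" "\<And>i. i \<in> S \<Longrightarrow> coeffs_in M (f i)"
  shows "coeffs_in M (sum f S)"
  using assms(3)
  by (induction S rule: infinite_finite_induct) (use assms(1,2) in \<open>auto simp: coeffs_in_def lookup_add\<close>)

lemma coeffs_in_mult:
  fixes p r :: "'c::comm_ring_1 mpol"
  assumes zero: "0 \<in> M" and add: "\<And>x y. x \<in> M \<Longrightarrow> y \<in> M \<Longrightarrow> x + y \<in> M"
    and mult: "\<And>m n. Poly_Mapping.lookup p m * Poly_Mapping.lookup r n \<in> M"
  shows "coeffs_in M (p * r)"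
proof -
  have "p * r = (\<Sum>m\<in>Poly_Mapping.keys p. \<Sum>n\<in>Poly_Mapping.keys r. Poly_Mapping.single (m + n) (Poly_Mapping.lookup p m * Poly_Mapping.lookup r n))"
    by (subst (1) poly_mapping_sum_single[of p], subst (1) poly_mapping_sum_single[of r])
       (simp add: sum_product mult_single)
  also have "coeffs_in M \<dots>"
    using zero mult by (intro coeffs_in_sum zero add) (auto simp: coeffs_in_def lookup_single when_def)
  finally show ?thesis .
qed

lemma coeffs_in_mono: "coeffs_in M f \<Longrightarrow> M \<subseteq> N \<Longrightarrow> coeffs_in N f"
  by (auto simp: coeffs_in_def)

lemma coeffs_in_prod:
  fixes f :: "'i \<Rightarrow> 'c::comm_ring_1 mpol"
  assumes "0 \<in> M" "1 \<in> M" "\<And>x y. x \<in> M \<Longrightarrow> y \<in> M \<Longrightarrow> x + y \<in> M" "\<And>x y. x \<in> M \<Longrightarrow> y \<in> M \<Longrightarrow> x * y \<in> M"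
    and "\<And>i. i \<in> S \<Longrightarrow> coeffs_in M (f i)"
  shows "coeffs_in M (prod f S)"
  using assms(5)
proof (induction S rule: infinite_finite_induct)
  case (insert x F)
  have "coeffs_in M (f x)" "coeffs_in M (prod f F)" using insert by auto
  hence "coeffs_in M (f x * prod f F)"
    by (intro coeffs_in_mult assms(1,3,4)) (simp_all add: coeffs_in_def)
  thus ?case using insert by simp
qed (use assms(1,2) in \<open>auto simp: coeffs_in_def lookup_one when_def\<close>)

lemma coeffs_in_mconst_mult:
  fixes p :: "'c::comm_ring_1 mpol"
  assumes "\<And>m. x * Poly_Mapping.lookup p m \<in> M"
  shows "coeffs_in M (mconst x * p)"
  using assms by (simp add: coeffs_in_def lookup_mconst_mult)

text \<open>
  For \<open>n = q\<close> in characteristic \<open>p\<close> this is the ring endomorphism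
  that raises coefficients to the \<open>q\<close>-th power and fixes the variables.
\<close>

definition twist :: "nat \<Rightarrow> 'c::comm_ring_1 mpol \<Rightarrow> 'c mpol" where
  "twist n p = Poly_Mapping.map (\<lambda>x. x ^ n) p"

lemma lookup_twist: "n > 0 \<Longrightarrow> Poly_Mapping.lookup (twist n p) m = Poly_Mapping.lookup p m ^ n"
  by (simp add: twist_def map.rep_eq when_def zero_power)

lemma twist_single: "n > 0 \<Longrightarrow> twist n (Poly_Mapping.single m c) = Poly_Mapping.single m (c ^ n)"
  by (simp add: twist_def zero_power)

lemma twist_add:
  fixes p r :: "'c::comm_ring_1 mpol"
  assumes "CHAR('c) = CHAR('q::finite_field)"
  shows "twist CARD('q) (p + r) = twist CARD('q) p + twist CARD('q) r"
  by (rule poly_mapping_eqI)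
     (simp add: lookup_twist lookup_add add_power_card[OF assms] finite_UNIV_card_ge_0)

lemma twist_0 [simp]: "twist n 0 = 0"
  by (simp add: twist_def map_eq_zero_iff)

lemma twist_sum:
  fixes f :: "'i \<Rightarrow> 'c::comm_ring_1 mpol"
  assumes "CHAR('c) = CHAR('q::finite_field)"
  shows "twist CARD('q) (sum f S) = (\<Sum>x\<in>S. twist CARD('q) (f x))"
  by (induction S rule: infinite_finite_induct) (simp_all add: twist_add[OF assms])

lemma twist_mult:
  fixes p r :: "'c::comm_ring_1 mpol"
  assumes "CHAR('c) = CHAR('q::finite_field)"
  shows "twist CARD('q) (p * r) = twist CARD('q) p * twist CARD('q) r"
proof (induction p rule: poly_mapping_single_add_induct)
  case (single m c)
  show ?case
    by (induction r rule: poly_mapping_single_add_induct)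
       (simp_all add: mult_single twist_single finite_UNIV_card_ge_0 power_mult_distrib ring_distribs twist_add[OF assms])
qed (simp_all add: ring_distribs twist_add[OF assms])

lemma twist_mconst: "n > 0 \<Longrightarrow> twist n (mconst c) = mconst (c ^ n)"
  by (simp add: mconst_def twist_single)

lemma twist_1: "n > 0 \<Longrightarrow> twist n 1 = 1"
  using twist_mconst[of n 1] by simp

lemma twist_mvar: "n > 0 \<Longrightarrow> twist n (mvar v) = mvar v"
  by (simp add: mvar_def twist_single)

lemma twist_prod:
  fixes f :: "'i \<Rightarrow> 'c::comm_ring_1 mpol"
  assumes "CHAR('c) = CHAR('q::finite_field)"
  shows "twist CARD('q) (prod f S) = (\<Prod>x\<in>S. twist CARD('q) (f x))"
  by (induction S rule: infinite_finite_induct)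
     (simp_all add: twist_mult[OF assms] twist_1 finite_UNIV_card_ge_0)

definition poly_in_var :: "'c::comm_ring_1 poly \<Rightarrow> nat \<Rightarrow> 'c mpol" where
  "poly_in_var \<beta> v = poly (map_poly mconst \<beta>) (mvar v)"

lemma poly_in_var_0 [simp]: "poly_in_var 0 v = 0"
  by (simp add: poly_in_var_def)

lemma poly_in_var_pCons: "poly_in_var (pCons c \<beta>) v = mconst c + mvar v * poly_in_var \<beta> v"
  by (simp add: poly_in_var_def map_poly_pCons)

lemma mvar_power: "mvar v ^ i = Poly_Mapping.single (Poly_Mapping.single v i) (1::'c::comm_ring_1)"
  by (induction i) (simp_all add: mvar_def mult_single flip: single_add)

lemma poly_in_var_altdef:
  "poly_in_var \<beta> v = (\<Sum>i\<le>degree \<beta>. Poly_Mapping.single (Poly_Mapping.single v i) (coeff \<beta> i))"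
proof -
  have "poly_in_var \<beta> v = (\<Sum>i\<le>degree \<beta>. mconst (coeff \<beta> i) * mvar v ^ i)"
  proof (cases "\<beta> = 0")
    case False
    have "degree (map_poly mconst \<beta>) \<le> degree \<beta>" by (rule map_poly_degree_leq)
    hence "poly_in_var \<beta> v = (\<Sum>i\<le>degree \<beta>. coeff (map_poly mconst \<beta>) i * mvar v ^ i)"
      unfolding poly_in_var_def poly_altdef
      by (intro sum.mono_neutral_left) (auto simp: coeff_eq_0)
    thus ?thesis by (simp add: coeff_map_poly)
  qed simp
  thus ?thesis by (simp add: mvar_power mconst_def mult_single)
qed

lemma coeffs_in_poly_in_var:
  assumes "0 \<in> M" "\<And>x y. x \<in> M \<Longrightarrow> y \<in> M \<Longrightarrow> x + y \<in> M" "\<And>i. coeff \<beta> i \<in> M"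
  shows "coeffs_in M (poly_in_var \<beta> v)"
  unfolding poly_in_var_altdef using assms
  by (intro coeffs_in_sum) (auto simp: coeffs_in_def lookup_single when_def)

section \<open>Linear substitution slot by slot\<close>

text \<open>
  The linear map that sends \<open>t\<^sup>m\<close> to \<open>\<Prod>\<^bsub>j<k\<^esub> G j
  (m\<^sub>j)\<close>. It is a substitution of variables only when each \<open>G j\<close> is a
  sequence of powers. In the application \<open>G j e\<close> is
  \<open>C\<^bsub>\<theta>^e\<^esub>\<close> at the \<open>j\<close>-th variable, which is an
  \<open>e\<close>-th power under composition but not under multiplication.
\<close>

definition slot_eval :: "nat \<Rightarrow> (nat \<Rightarrow> nat \<Rightarrow> 'c mpol) \<Rightarrow> 'c mpol \<Rightarrow> 'c::comm_ring_1 mpol" where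
  "slot_eval k G p = (\<Sum>m\<in>Poly_Mapping.keys p. mconst (Poly_Mapping.lookup p m) * (\<Prod>j<k. G j (Poly_Mapping.lookup m j)))"

lemma slot_eval_superset:
  assumes "finite S" "Poly_Mapping.keys p \<subseteq> S"
  shows "slot_eval k G p = (\<Sum>m\<in>S. mconst (Poly_Mapping.lookup p m) * (\<Prod>j<k. G j (Poly_Mapping.lookup m j)))"
  unfolding slot_eval_def by (rule sum.mono_neutral_left) (use assms in \<open>auto simp: in_keys_iff\<close>)

lemma slot_eval_0 [simp]: "slot_eval k G 0 = 0"
  by (simp add: slot_eval_def)

lemma slot_eval_add: "slot_eval k G (p + r) = slot_eval k G p + slot_eval k G r"
  unfolding slot_eval_def
  by (rule setsum_keys_plus_distrib[where f = "\<lambda>m c. mconst c * (\<Prod>j<k. G j (Poly_Mapping.lookup m j))"])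
     (simp_all add: mconst_add ring_distribs)

lemma slot_eval_sum: "slot_eval k G (sum f S) = (\<Sum>x\<in>S. slot_eval k G (f x))"
  by (induction S rule: infinite_finite_induct) (simp_all add: slot_eval_add)

lemma slot_eval_single:
  "slot_eval k G (Poly_Mapping.single m c) = mconst c * (\<Prod>j<k. G j (Poly_Mapping.lookup m j))"
  by (subst slot_eval_superset[of "{m}"]) auto

lemma slot_eval_mconst_mult: "slot_eval k G (mconst c * p) = mconst c * slot_eval k G p"
proof -
  have sub: "Poly_Mapping.keys (mconst c * p) \<subseteq> Poly_Mapping.keys p" by (auto simp: in_keys_iff lookup_mconst_mult)
  show ?thesis
    by (subst slot_eval_superset[OF _ sub])
       (simp_all add: slot_eval_def lookup_mconst_mult mconst_mult sum_distrib_left mult.assoc)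
qed

lemma slot_eval_1: "slot_eval k G 1 = (\<Prod>j<k. G j 0)"
  using slot_eval_single[of k G 0 1] by simp

text \<open>
  The sequence that replaces \<open>G j\<close> when the argument of \<open>slot_eval\<close>
  is multiplied by \<open>\<beta>(t\<^sub>j)\<close>.
\<close>

definition shift_by :: "'c::comm_ring_1 poly \<Rightarrow> (nat \<Rightarrow> 'c mpol) \<Rightarrow> nat \<Rightarrow> 'c mpol" where
  "shift_by \<beta> g e = (\<Sum>i\<le>degree \<beta>. mconst (coeff \<beta> i) * g (e + i))"

lemma slot_eval_poly_in_var_mult:
  assumes v: "v < k"
  shows "slot_eval k G (poly_in_var \<beta> v * p) = slot_eval k (G(v := shift_by \<beta> (G v))) p"
proof (induction p rule: poly_mapping_single_add_induct)
  case (add p r)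
  thus ?case by (simp add: ring_distribs slot_eval_add)
next
  case (single m c)
  have remove: "(\<Prod>j<k. H j) = H v * (\<Prod>j\<in>{..<k} - {v}. H j)" for H :: "nat \<Rightarrow> 'a mpol"
    using v by (subst prod.remove[of _ v]) auto
  have "slot_eval k G (poly_in_var \<beta> v * Poly_Mapping.single m c) =
          (\<Sum>i\<le>degree \<beta>. mconst (coeff \<beta> i * c) * (\<Prod>j<k. G j (Poly_Mapping.lookup (Poly_Mapping.single v i + m) j)))"
    by (simp add: poly_in_var_altdef sum_distrib_right mult_single slot_eval_sum slot_eval_single)
  also have "\<dots> = (\<Sum>i\<le>degree \<beta>. mconst c * (mconst (coeff \<beta> i) * G v (Poly_Mapping.lookup m v + i)
                     * (\<Prod>j\<in>{..<k} - {v}. G j (Poly_Mapping.lookup m j))))"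
  proof (intro sum.cong refl)
    fix i
    have "(\<Prod>j<k. G j (Poly_Mapping.lookup (Poly_Mapping.single v i + m) j))
            = G v (Poly_Mapping.lookup m v + i) * (\<Prod>j\<in>{..<k} - {v}. G j (Poly_Mapping.lookup m j))"
      unfolding remove by (intro arg_cong2[of _ _ _ _ "(*)"] prod.cong)
        (auto simp: lookup_add lookup_single add.commute)
    thus "mconst (coeff \<beta> i * c) * (\<Prod>j<k. G j (Poly_Mapping.lookup (Poly_Mapping.single v i + m) j)) =
            mconst c * (mconst (coeff \<beta> i) * G v (Poly_Mapping.lookup m v + i) * (\<Prod>j\<in>{..<k} - {v}. G j (Poly_Mapping.lookup m j)))"
      by (simp add: mconst_mult mult_ac)
  qed
  also have "\<dots> = slot_eval k (G(v := shift_by \<beta> (G v))) (Poly_Mapping.single m c)"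
    unfolding slot_eval_single remove
    by (simp add: shift_by_def sum_distrib_left sum_distrib_right)
  finally show ?case .
qed

lemma slot_eval_prod_poly_in_var_mult:
  "slot_eval k G ((\<Prod>v<k. poly_in_var \<beta> v) * p) = slot_eval k (\<lambda>j. shift_by \<beta> (G j)) p"
proof -
  have "slot_eval k G ((\<Prod>v\<in>J. poly_in_var \<beta> v) * p)
          = slot_eval k (\<lambda>j. if j \<in> J then shift_by \<beta> (G j) else G j) p" if "J \<subseteq> {..<k}" "finite J" for J
    using that(2,1)
  proof (induction J arbitrary: p rule: finite_induct)
    case (insert v J)
    let ?G = "\<lambda>j. if j \<in> J then shift_by \<beta> (G j) else G j"
    have "slot_eval k G ((\<Prod>v\<in>insert v J. poly_in_var \<beta> v) * p)
            = slot_eval k ?G (poly_in_var \<beta> v * p)"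
      using insert by (subst insert.IH[of "poly_in_var \<beta> v * p", symmetric]) (simp_all add: mult_ac)
    also have "\<dots> = slot_eval k (?G(v := shift_by \<beta> (?G v))) p"
      using insert by (intro slot_eval_poly_in_var_mult) auto
    also have "?G(v := shift_by \<beta> (?G v)) = (\<lambda>j. if j \<in> insert v J then shift_by \<beta> (G j) else G j)"
      using insert by auto
    finally show ?case .
  qed simp
  from this[of "{..<k}"] have "slot_eval k G ((\<Prod>v<k. poly_in_var \<beta> v) * p)
      = slot_eval k (\<lambda>j. if j \<in> {..<k} then shift_by \<beta> (G j) else G j) p" by simp
  also have "\<dots> = slot_eval k (\<lambda>j. shift_by \<beta> (G j)) p"
    unfolding slot_eval_def by simp
  finally show ?thesis .
qed

lemma slot_eval_twist:
  fixes p :: "'c::comm_ring_1 mpol"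
  assumes "CHAR('c) = CHAR('q::finite_field)"
  shows "slot_eval k (\<lambda>j e. G j e ^ CARD('q)) (twist CARD('q) p) = slot_eval k G p ^ CARD('q)"
proof -
  have q: "CARD('q) > 0" by simp
  have sub: "Poly_Mapping.keys (twist CARD('q) p) \<subseteq> Poly_Mapping.keys p" using q by (auto simp: in_keys_iff lookup_twist zero_power)
  show ?thesis
    by (subst slot_eval_superset[OF _ sub])
       (simp_all add: slot_eval_def lookup_twist mconst_power sum_power_card[where ?'q='q] CHAR_mpol
          assms power_mult_distrib prod_power_distrib)
qed

section \<open>The ring \<open>A\<close> inside \<open>\<bbbC>\<^sub>\<infinity>\<close> and its localizations\<close>

context C_infinity
begin

abbreviation \<iota> :: "'q poly \<Rightarrow> 'c" where "\<iota> \<equiv> A_emb emb"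

abbreviation \<theta> :: 'c where "\<theta> \<equiv> \<iota> [:0, 1:]"

abbreviation absv :: "'c \<Rightarrow> real" where "absv x \<equiv> dist x 0"

lemma emb_0: "emb 0 = 0"
  using emb_add[of 0 0] by (metis add_0_right add_left_cancel)

lemma iota_add: "\<iota> (a + b) = \<iota> a + \<iota> b"
  by (simp add: A_emb_def poly_map_poly_hom_add fls_plus_const emb_add)

lemma iota_mult: "\<iota> (a * b) = \<iota> a * \<iota> b"
  by (simp add: A_emb_def poly_map_poly_hom_mult fls_plus_const emb_mult)

lemma iota_1 [simp]: "\<iota> 1 = 1"
  by (simp add: A_emb_def emb_1)

lemma iota_0 [simp]: "\<iota> 0 = 0"
  by (simp add: A_emb_def emb_0)

lemma iota_diff: "\<iota> (a - b) = \<iota> a - \<iota> b"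
  using iota_add[of "a - b" b] by (simp add: algebra_simps)

lemma iota_power: "\<iota> (a ^ n) = \<iota> a ^ n"
  by (induction n) (simp_all add: iota_mult)

text \<open>
  In \<open>\<bbbF>\<^sub>q((1/\<theta>))\<close> the lowest term of a polynomial in
  \<open>\<theta>\<close> is its leading term.
\<close>

lemma absv_iota:
  assumes "a \<noteq> 0"
  shows "absv (\<iota> a) = real CARD('q) ^ degree a"
proof -
  let ?e = "\<lambda>a :: 'q poly. poly (map_poly fls_const a) fls_X_inv"
  have "?e a \<noteq> 0 \<and> fls_subdegree (?e a) = - int (degree a)"
    using assms
  proof (induction a)
    case (pCons c a)
    show ?case
    proof (cases "a = 0")
      case True
      thus ?thesis using pCons.hyps by (simp add: map_poly_pCons)
    next
      case False
      define w where "w = fls_X_inv * ?e a"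
      have w: "w \<noteq> 0" "fls_subdegree w = - int (degree (pCons c a))"
        using pCons.IH False by (simp_all add: w_def fls_subdegree_mult_fls_X_inv)
      have "fls_subdegree (fls_const c + w) = fls_subdegree w"
        using w False by (intro fls_subdegree_add_eq2) simp_all
      moreover have "?e (pCons c a) = fls_const c + w"
        by (simp add: map_poly_pCons w_def)
      ultimately show ?thesis using w False by auto
    qed
  qed simp
  thus ?thesis using dist_emb[of "?e a"] by (simp add: A_emb_def)
qed

lemma iota_eq_0_iff [simp]: "\<iota> a = 0 \<longleftrightarrow> a = 0"
proof
  assume "\<iota> a = 0"
  hence "absv (\<iota> a) = 0" by simp
  thus "a = 0" using absv_iota[of a] by auto
qed simp

lemma iota_eq_iff [simp]: "\<iota> a = \<iota> b \<longleftrightarrow> a = b"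
  using iota_eq_0_iff[of "a - b"] unfolding iota_diff by simp

lemma iota_const_power_card: "\<iota> [:c:] ^ CARD('q) = \<iota> [:c:]"
  by (simp flip: iota_power add: const_poly_power_card)

lemma CHAR_eq: "CHAR('c) = CHAR('q)"
proof (rule CHAR_eqI)
  have "of_nat n = \<iota> (of_nat n)" for n by (induction n) (simp_all add: iota_add)
  hence *: "of_nat n = (0 :: 'c) \<longleftrightarrow> of_nat n = (0 :: 'q poly)" for n by simp
  show "of_nat CHAR('q) = (0 :: 'c)" by (simp add: * of_nat_eq_0_iff_char_dvd)
  show "CHAR('q) dvd n" if "of_nat n = (0 :: 'c)" for n
    using that by (simp add: * of_nat_eq_0_iff_char_dvd)
qed

lemma card_pos: "CARD('q) > 0" by simp

lemmas tw_add = twist_add[OF CHAR_eq]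
lemmas tw_sum = twist_sum[OF CHAR_eq]
lemmas tw_mult = twist_mult[OF CHAR_eq]
lemmas tw_mconst = twist_mconst[OF card_pos]
lemmas tw_mvar = twist_mvar[OF card_pos]
lemmas tw_prod = twist_prod[OF CHAR_eq]

text \<open>
  The local ring \<open>A\<^bsub>(P)\<^esub>\<close> and its maximal ideal, as subsets of
  \<open>\<bbbC>\<^sub>\<infinity>\<close>.
\<close>

definition localization :: "'q poly \<Rightarrow> 'c set" where
  "localization P = {x. \<exists>a b. \<not> P dvd b \<and> x * \<iota> b = \<iota> a}"

definition max_ideal :: "'q poly \<Rightarrow> 'c set" where
  "max_ideal P = (*) (\<iota> P) ` localization P"

lemma localizationI: "\<not> P dvd b \<Longrightarrow> x * \<iota> b = \<iota> a \<Longrightarrow> x \<in> localization P"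
  unfolding localization_def by blast

lemma localizationE:
  assumes "x \<in> localization P"
  obtains a b where "\<not> P dvd b" "x * \<iota> b = \<iota> a"
  using assms unfolding localization_def by blast

lemma iota_in_localization:
  assumes "prime_elem P"
  shows "\<iota> a \<in> localization P"
  using assms prime_elem_not_unit[of P] by (intro localizationI[of P 1 _ a]) auto

lemma localization_0 [simp]: "prime_elem P \<Longrightarrow> 0 \<in> localization P"
  using iota_in_localization[of P 0] by simp

lemma localization_add:
  assumes "prime_elem P" "x \<in> localization P" "y \<in> localization P"
  shows "x + y \<in> localization P"
proof -
  obtain a b a' b' where *: "\<not> P dvd b" "x * \<iota> b = \<iota> a" "\<not> P dvd b'" "y * \<iota> b' = \<iota> a'"
    using assms unfolding localization_def by blast
  have "(x + y) * \<iota> (b * b') = (x * \<iota> b) * \<iota> b' + (y * \<iota> b') * \<iota> b"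
    by (simp add: iota_mult algebra_simps)
  also have "\<dots> = \<iota> (a * b' + a' * b)" by (simp add: * iota_mult iota_add)
  finally show ?thesis using * assms(1) by (intro localizationI) (auto simp: prime_elem_dvd_mult_iff)
qed

lemma localization_mult:
  assumes "prime_elem P" "x \<in> localization P" "y \<in> localization P"
  shows "x * y \<in> localization P"
proof -
  obtain a b a' b' where *: "\<not> P dvd b" "x * \<iota> b = \<iota> a" "\<not> P dvd b'" "y * \<iota> b' = \<iota> a'"
    using assms unfolding localization_def by blast
  have "(x * y) * \<iota> (b * b') = (x * \<iota> b) * (y * \<iota> b')"
    by (simp add: iota_mult algebra_simps)
  also have "\<dots> = \<iota> (a * a')" by (simp add: * iota_mult)
  finally show ?thesis using * assms(1) by (intro localizationI) (auto simp: prime_elem_dvd_mult_iff)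
qed

lemma inverse_iota_in_localization:
  assumes "\<not> P dvd b"
  shows "inverse (\<iota> b) \<in> localization P"
proof -
  have "b \<noteq> 0" using assms by auto
  thus ?thesis using assms by (intro localizationI[of P b _ 1]) auto
qed

lemma max_ideal_0 [simp]: "prime_elem P \<Longrightarrow> 0 \<in> max_ideal P"
  unfolding max_ideal_def by (rule image_eqI[of _ _ 0]) auto

lemma max_ideal_add:
  assumes "prime_elem P" "x \<in> max_ideal P" "y \<in> max_ideal P"
  shows "x + y \<in> max_ideal P"
  using assms localization_add unfolding max_ideal_def by (auto simp flip: distrib_left)

lemma max_ideal_mult:
  assumes "prime_elem P" "x \<in> localization P" "y \<in> max_ideal P"
  shows "x * y \<in> max_ideal P"
  using assms localization_mult unfolding max_ideal_def by (auto simp: mult.left_commute)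

lemma max_ideal_mult':
  assumes "prime_elem P" "x \<in> max_ideal P" "y \<in> localization P"
  shows "x * y \<in> max_ideal P"
  using max_ideal_mult[OF assms(1,3,2)] by (simp add: mult.commute)

lemma iota_in_max_ideal:
  assumes "prime_elem P" "P dvd a"
  shows "\<iota> a \<in> max_ideal P"
  using assms iota_in_localization unfolding max_ideal_def by (auto elim!: dvdE simp: iota_mult)

text \<open>
  A denominator of least degree cannot have a prime factor \<open>P\<close>: comparison with a
  denominator prime to \<open>P\<close> would allow \<open>P\<close> to be cancelled.
\<close>

lemma in_range_iota_if_in_localizations:
  assumes "\<And>P. prime_elem P \<Longrightarrow> lead_coeff P = 1 \<Longrightarrow> degree P > 0 \<Longrightarrow> x \<in> localization P"
  shows "x \<in> range \<iota>"
proof -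
  let ?Q = "\<lambda>b. b \<noteq> 0 \<and> (\<exists>a. x * \<iota> b = \<iota> a)"
  obtain P :: "'q poly" where "prime_elem P" "lead_coeff P = 1" "degree P > 0"
    using obtain_monic_prime_divisor[of "[:0, 1:] :: 'q poly"] by auto
  from assms[OF this] obtain a0 b0 where "\<not> P dvd b0" "x * \<iota> b0 = \<iota> a0" by (rule localizationE)
  hence b0: "?Q b0" by auto
  define b where "b = arg_min degree ?Q"
  have b: "?Q b" unfolding b_def using b0 by (rule arg_min_natI)
  have min: "degree b \<le> degree b'" if "?Q b'" for b'
    unfolding b_def using that by (rule arg_min_nat_le)
  from b obtain a where a: "x * \<iota> b = \<iota> a" by blast
  have "degree b = 0"
  proof (rule ccontr)
    assume "degree b \<noteq> 0"
    then obtain P where P: "prime_elem P" "lead_coeff P = 1" "degree P > 0" "P dvd b"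
      using obtain_monic_prime_divisor[of b] by auto
    then obtain a' b' where a': "\<not> P dvd b'" "x * \<iota> b' = \<iota> a'"
      using assms[of P] unfolding localization_def by auto
    have "\<iota> (a * b') = \<iota> (a' * b)"
      unfolding iota_mult a[symmetric] a'(2)[symmetric] by (simp add: mult_ac)
    hence "a * b' = a' * b" by simp
    hence "P dvd a * b'" using P(4) by simp
    hence "P dvd a" using P(1) a'(1) by (simp add: prime_elem_dvd_mult_iff)
    then obtain a2 b2 where ab2: "a = P * a2" "b = P * b2" using P(4) by (auto elim!: dvdE)
    have "P \<noteq> 0" "b2 \<noteq> 0" using P(3) b ab2 by auto
    hence "x * \<iota> b2 = \<iota> a2" using a by (simp add: ab2 iota_mult mult.left_commute)
    hence "degree b \<le> degree b2" using \<open>b2 \<noteq> 0\<close> by (intro min) auto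
    thus False using P(3) \<open>P \<noteq> 0\<close> \<open>b2 \<noteq> 0\<close> by (simp add: ab2 degree_mult_eq)
  qed
  then obtain c where c: "b = [:c:]" by (metis degree_0_id)
  have "c \<noteq> 0" using b c by auto
  hence "x = x * \<iota> (b * [:inverse c:])" by (simp add: c flip: one_pCons)
  also have "\<dots> = \<iota> (a * [:inverse c:])" unfolding iota_mult by (simp add: a flip: mult.assoc)
  finally show ?thesis by blast
qed

text \<open>
  Fermat's little theorem extends from \<open>A\<close> to fractions \<open>a/b\<close> through
  the identity \<open>a\<^sup>Q b - a b\<^sup>Q = (a\<^sup>Q - a) b - a (b\<^sup>Q -
  b)\<close>.
\<close>

lemma localization_power_card_power_degree:
  assumes P: "prime_elem P" "lead_coeff P = 1" "degree P > 0" and x: "x \<in> localization P"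
  shows "x ^ (CARD('q) ^ degree P) - x \<in> max_ideal P"
proof -
  let ?Q = "CARD('q) ^ degree P"
  obtain a b where ab: "\<not> P dvd b" "x * \<iota> b = \<iota> a" using x unfolding localization_def by auto
  have nz: "b \<noteq> 0" "P \<noteq> 0" using ab P(3) by auto
  have "P dvd (a ^ ?Q - a) * b - a * (b ^ ?Q - b)"
    by (intro dvd_diff dvd_mult[OF prime_dvd_power_card_power_degree_minus_self[OF P]]
          dvd_mult2[OF prime_dvd_power_card_power_degree_minus_self[OF P]])
  also have "(a ^ ?Q - a) * b - a * (b ^ ?Q - b) = a ^ ?Q * b - a * b ^ ?Q"
    by (simp add: algebra_simps)
  finally obtain w where w: "a ^ ?Q * b - a * b ^ ?Q = P * w" by (elim dvdE)
  define y where "y = (x ^ ?Q - x) / \<iota> P"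
  have "(x ^ ?Q - x) * \<iota> (b ^ ?Q * b) = (x * \<iota> b) ^ ?Q * \<iota> b - (x * \<iota> b) * \<iota> b ^ ?Q"
    by (simp add: iota_mult iota_power power_mult_distrib algebra_simps)
  also have "\<dots> = \<iota> (a ^ ?Q * b - a * b ^ ?Q)"
    by (simp only: ab(2) iota_diff iota_mult iota_power)
  finally have "y * \<iota> (b ^ ?Q * b) = \<iota> w" unfolding w using nz by (simp add: y_def iota_mult)
  moreover have "\<not> P dvd b ^ ?Q * b"
    using ab(1) P(1) by (auto simp: prime_elem_dvd_mult_iff dest: prime_elem_dvd_power)
  ultimately have "y \<in> localization P" unfolding localization_def by blast
  moreover have "x ^ ?Q - x = \<iota> P * y" using nz by (simp add: y_def)
  ultimately show ?thesis unfolding max_ideal_def by blast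
qed

lemma prime_power_div_carlitz_D:
  assumes P: "prime_elem P"
  shows "\<iota> P ^ (CARD('q) ^ i) * inverse (\<iota> (carlitz_D i)) \<in> max_ideal P"
proof -
  obtain a b where ab: "\<not> P dvd b" "P ^ (CARD('q) ^ i - 1) * b = carlitz_D i * a"
    using carlitz_D_dvd_prime_power[OF P] by blast
  define y where "y = \<iota> P ^ (CARD('q) ^ i - 1) * inverse (\<iota> (carlitz_D i))"
  have "y * \<iota> b = \<iota> (P ^ (CARD('q) ^ i - 1) * b) * inverse (\<iota> (carlitz_D i))"
    by (simp add: y_def iota_mult iota_power)
  also have "\<dots> = \<iota> a" unfolding ab(2) by (simp add: iota_mult carlitz_D_nonzero)
  finally have "y \<in> localization P" using ab(1) unfolding localization_def by blast
  moreover have "\<iota> P ^ (CARD('q) ^ i) = \<iota> P * \<iota> P ^ (CARD('q) ^ i - 1)"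
    by (simp flip: power_Suc)
  hence "\<iota> P ^ (CARD('q) ^ i) * inverse (\<iota> (carlitz_D i)) = \<iota> P * y" by (simp add: y_def)
  ultimately show ?thesis unfolding max_ideal_def by blast
qed

section \<open>The semilinear operator and its exponential\<close>

lemma q_gt_1: "CARD('q) > 1" by (rule CARD_finite_field_gt_1)

text \<open>
  The polynomial \<open>a(t\<^sub>v)\<close>: here \<open>\<theta>\<close> is replaced by the
  variable \<open>t\<^sub>v\<close>, so that only constants of \<open>\<bbbF>\<^sub>q\<close>
  are left as coefficients. Therefore \<open>a(t\<^sub>v)\<close> is fixed by
  \<open>twist\<close> and has Gauss norm at most 1.
\<close>

definition A_poly_in_var :: "'q poly \<Rightarrow> nat \<Rightarrow> 'c mpol" where
  "A_poly_in_var a v = poly_in_var (map_poly (\<lambda>c. \<iota> [:c:]) a) v"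

lemma A_poly_in_var_0 [simp]: "A_poly_in_var 0 v = 0"
  by (simp add: A_poly_in_var_def)

lemma A_poly_in_var_pCons:
  "A_poly_in_var (pCons c a) v = mconst (\<iota> [:c:]) + mvar v * A_poly_in_var a v"
  by (simp add: A_poly_in_var_def map_poly_pCons poly_in_var_pCons)

lemma A_poly_in_var_altdef:
  "A_poly_in_var a v = poly (map_poly (\<lambda>c. mconst (\<iota> [:c:])) a) (mvar v)"
  by (simp add: A_poly_in_var_def poly_in_var_def map_poly_map_poly o_def)

lemma A_poly_in_var_mult: "A_poly_in_var (a * b) v = A_poly_in_var a v * A_poly_in_var b v"
proof -
  have "[:x + y:] = [:x:] + [:y:]" "[:x * y:] = [:x:] * [:y:]" for x y :: 'q by simp_all
  thus ?thesis unfolding A_poly_in_var_altdef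
    by (intro poly_map_poly_hom_mult) (simp_all only: iota_add iota_mult mconst_add mconst_mult, simp flip: one_pCons)
qed

lemma twist_A_poly_in_var: "twist CARD('q) (A_poly_in_var a v) = A_poly_in_var a v"
proof (induction a)
  case 0
  show ?case using tw_mconst[of 0] by (simp add: zero_power)
next
  case (pCons c a)
  thus ?case
    by (simp add: A_poly_in_var_pCons tw_add tw_mult tw_mvar tw_mconst iota_const_power_card)
qed

lemma coeffs_in_A_poly_in_var:
  assumes "0 \<in> M" "\<And>x y. x \<in> M \<Longrightarrow> y \<in> M \<Longrightarrow> x + y \<in> M" "\<And>c. \<iota> [:c:] \<in> M"
  shows "coeffs_in M (A_poly_in_var a v)"
  unfolding A_poly_in_var_def using assms by (intro coeffs_in_poly_in_var) (auto simp: coeff_map_poly)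

definition theta_factor :: "nat \<Rightarrow> 'c mpol" where
  "theta_factor v = poly_in_var [:- \<theta>, 1:] v"

lemma theta_factor_eq: "theta_factor v = mvar v - mconst \<theta>"
  by (simp add: theta_factor_def poly_in_var_pCons mconst_uminus)

text \<open>
  \<open>basis_poly j v\<close> is \<open>(t\<^sub>v - \<theta>) (t\<^sub>v - \<theta>\<^sup>q)
  \<dots> (t\<^sub>v - \<theta>\<^bsup>q^(j-1)\<^esup>)\<close>, the counterpart of the
  monomial \<open>X\<^bsup>q^j\<^esup>\<close>. The recursive form exhibits it as the
  \<open>j\<close>-th iterate at 1 of \<open>f \<mapsto> (t\<^sub>v - \<theta>)
  \<tau>(f)\<close>.
\<close>

primrec basis_poly :: "nat \<Rightarrow> nat \<Rightarrow> 'c mpol" where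
  "basis_poly 0 v = 1"
| "basis_poly (Suc j) v = theta_factor v * twist CARD('q) (basis_poly j v)"

text \<open>
  Let \<open>\<theta> + \<phi>\<^sub>v\<close> with \<open>\<phi>\<^sub>v(f) = (t\<^sub>v - \<theta>) \<tau>(f)\<close> play the part of \<open>C\<^sub>\<theta>\<close>. As \<open>\<tau>\<close> fixes \<open>a(t\<^sub>v)\<close>, this operator
  multiplies \<open>a(t\<^sub>v)\<close> by \<open>t\<^sub>v\<close>. By the Horner scheme the operator that plays the part of \<open>C\<^sub>a\<close> therefore
  sends 1 to \<open>a(t\<^sub>v)\<close>; written out, this is the expansion.
\<close>

lemma A_poly_in_var_expand:
  assumes "degree a \<le> n"
  shows "A_poly_in_var a v = (\<Sum>j\<le>n. mconst (\<iota> (carlitz_coeff a j)) * basis_poly j v)"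
  using assms
proof (induction a arbitrary: n)
  case (pCons c a)
  show ?case
  proof (cases "a = 0")
    case True
    have "(\<Sum>j\<le>n. mconst (\<iota> (carlitz_coeff [:c:] j)) * basis_poly j v)
            = (\<Sum>j\<in>{0}. mconst (\<iota> (carlitz_coeff [:c:] j)) * basis_poly j v)"
      by (rule sum.mono_neutral_right) (auto simp: carlitz_coeff_pCons zero_power)
    thus ?thesis using True by (simp add: A_poly_in_var_pCons)
  next
    case False
    then obtain m where n: "n = Suc m" and m: "degree a \<le> m"
      using pCons.prems by (cases n) auto
    let ?B = "\<lambda>j. basis_poly j v" and ?c = "\<lambda>j. carlitz_coeff a j"
    have IH: "A_poly_in_var a v = (\<Sum>j\<le>m. mconst (\<iota> (?c j)) * ?B j)"
      and IH': "A_poly_in_var a v = (\<Sum>j\<le>n. mconst (\<iota> (?c j)) * ?B j)"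
      using pCons.IH[of m] pCons.IH[of n] m n by auto
    have "theta_factor v * twist CARD('q) (A_poly_in_var a v) = (\<Sum>j\<le>m. mconst (\<iota> (?c j ^ CARD('q))) * ?B (Suc j))"
      unfolding IH by (simp add: tw_sum tw_mult tw_mconst iota_power sum_distrib_left mult_ac)
    hence step: "mvar v * A_poly_in_var a v = mconst \<theta> * A_poly_in_var a v
                   + (\<Sum>j\<le>m. mconst (\<iota> (?c j ^ CARD('q))) * ?B (Suc j))"
      by (simp add: twist_A_poly_in_var theta_factor_eq algebra_simps)
    have "(\<Sum>j\<le>n. mconst (\<iota> (carlitz_coeff (pCons c a) j)) * ?B j)
            = (\<Sum>j\<le>n. (if j = 0 then mconst (\<iota> [:c:]) else 0)
                  + mconst \<theta> * (mconst (\<iota> (?c j)) * ?B j)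
                  + (if j = 0 then 0 else mconst (\<iota> (?c (j - 1) ^ CARD('q))) * ?B j))"
    proof (intro sum.cong refl)
      fix j
      show "mconst (\<iota> (carlitz_coeff (pCons c a) j)) * ?B j
              = (if j = 0 then mconst (\<iota> [:c:]) else 0) + mconst \<theta> * (mconst (\<iota> (?c j)) * ?B j)
                  + (if j = 0 then 0 else mconst (\<iota> (?c (j - 1) ^ CARD('q))) * ?B j)"
        unfolding carlitz_coeff_pCons iota_add iota_mult mconst_add mconst_mult
        by (cases j) (simp_all add: ring_distribs mult.assoc)
    qed
    also have "\<dots> = mconst (\<iota> [:c:]) + mconst \<theta> * A_poly_in_var a v
                  + (\<Sum>j\<le>n. if j = 0 then 0 else mconst (\<iota> (?c (j - 1) ^ CARD('q))) * ?B j)"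
      unfolding IH' by (simp add: sum.distrib sum_distrib_left)
    also have "(\<Sum>j\<le>n. if j = 0 then 0 else mconst (\<iota> (?c (j - 1) ^ CARD('q))) * ?B j)
                 = (\<Sum>j\<le>m. mconst (\<iota> (?c j ^ CARD('q))) * ?B (Suc j))"
      unfolding n sum.atMost_Suc_shift by simp
    finally show ?thesis unfolding A_poly_in_var_pCons step by (simp add: algebra_simps)
  qed
qed simp

definition A_poly_in_vars :: "nat \<Rightarrow> 'q poly \<Rightarrow> 'c mpol" where
  "A_poly_in_vars k a = (\<Prod>v<k. A_poly_in_var a v)"

lemma A_poly_in_vars_mult: "A_poly_in_vars k (a * b) = A_poly_in_vars k a * A_poly_in_vars k b"
  by (simp add: A_poly_in_vars_def A_poly_in_var_mult prod.distrib)

definition phi :: "nat \<Rightarrow> 'c mpol \<Rightarrow> 'c mpol" where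
  "phi k f = (\<Prod>v<k. theta_factor v) * twist CARD('q) f"

lemma phi_add: "phi k (f + g) = phi k f + phi k g"
  by (simp add: phi_def tw_add ring_distribs)

lemma phi_0 [simp]: "phi k 0 = 0"
  by (simp add: phi_def)

lemma phi_sum: "phi k (sum f S) = (\<Sum>x\<in>S. phi k (f x))"
  by (induction S rule: infinite_finite_induct) (simp_all add: phi_add)

lemma phi_mconst_mult: "phi k (mconst x * f) = mconst (x ^ CARD('q)) * phi k f"
  by (simp add: phi_def tw_mult tw_mconst mult_ac)

lemma phi_A_poly_in_vars_mult: "phi k (A_poly_in_vars k a * f) = A_poly_in_vars k a * phi k f"
  by (simp add: phi_def tw_mult A_poly_in_vars_def tw_prod twist_A_poly_in_var mult_ac)

lemma phi_pow_add: "(phi k ^^ i) (f + g) = (phi k ^^ i) f + (phi k ^^ i) g"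
  by (induction i) (simp_all add: phi_add)

lemma phi_pow_0 [simp]: "(phi k ^^ i) 0 = 0"
  by (induction i) simp_all

lemma phi_pow_mconst_mult: "(phi k ^^ i) (mconst x * f) = mconst (x ^ (CARD('q) ^ i)) * (phi k ^^ i) f"
proof (induction i)
  case (Suc i)
  have "(x ^ (CARD('q) ^ i)) ^ CARD('q) = x ^ (CARD('q) ^ Suc i)"
    by (simp add: mult.commute flip: power_mult)
  thus ?case by (simp add: Suc phi_mconst_mult)
qed simp

lemma phi_pow_A_poly_in_vars_mult: "(phi k ^^ i) (A_poly_in_vars k a * f) = A_poly_in_vars k a * (phi k ^^ i) f"
  by (induction i) (simp_all add: phi_A_poly_in_vars_mult)

lemma phi_pow_eq: "(phi k ^^ i) f = (\<Prod>v<k. basis_poly i v) * (twist CARD('q) ^^ i) f"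
proof (induction i)
  case (Suc i)
  have "(phi k ^^ Suc i) f = phi k ((\<Prod>v<k. basis_poly i v) * (twist CARD('q) ^^ i) f)"
    by (simp add: Suc)
  also have "\<dots> = (\<Prod>v<k. basis_poly (Suc i) v) * (twist CARD('q) ^^ Suc i) f"
    by (simp add: phi_def tw_mult tw_prod prod.distrib mult.assoc)
  finally show ?case .
qed simp

text \<open>
  If the sequence \<open>f\<close> stands for the series \<open>\<Sum>\<^sub>m f\<^sub>m
  Z\<^bsup>q^m\<^esup>\<close>, then \<open>exp_phi k f n\<close> is the coefficient of
  \<open>Z\<^bsup>q^n\<^esup>\<close> in its Carlitz exponential, formed with
  \<open>\<phi>\<close> instead of the \<open>q\<close>-th power map.
\<close>

definition exp_phi :: "nat \<Rightarrow> (nat \<Rightarrow> 'c mpol) \<Rightarrow> nat \<Rightarrow> 'c mpol" where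
  "exp_phi k f n = (\<Sum>i\<le>n. mconst (inverse (\<iota> (carlitz_D i))) * (phi k ^^ i) (f (n - i)))"

lemma exp_phi_add: "exp_phi k (\<lambda>n. f n + g n) n = exp_phi k f n + exp_phi k g n"
  by (simp add: exp_phi_def phi_pow_add ring_distribs sum.distrib)

lemma exp_phi_const_mult: "exp_phi k (\<lambda>n. mconst (\<iota> [:c:]) * f n) n = mconst (\<iota> [:c:]) * exp_phi k f n"
proof -
  have "\<iota> [:c:] ^ (CARD('q) ^ i) = \<iota> [:c:]" for i
    by (simp flip: iota_power add: const_poly_power_card_power)
  thus ?thesis by (simp add: exp_phi_def phi_pow_mconst_mult sum_distrib_left mult.left_commute)
qed

text \<open>
  The functional equation \<open>exp\<^sub>C(\<theta> G) =
  C\<^sub>\<theta>(exp\<^sub>C(G))\<close>, coefficient by coefficient. It follows from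
  additivity and \<open>q\<close>-semilinearity of \<open>\<phi>\<close> together with
  \<open>(\<theta>\<^bsup>q^i\<^esup> - \<theta>) / D\<^sub>i = 1 /
  D\<^bsub>i-1\<^esub>\<^sup>q\<close>.
\<close>

lemma exp_phi_theta_mult:
  "exp_phi k (\<lambda>n. mconst \<theta> * f n) n
     = mconst \<theta> * exp_phi k f n + (if n = 0 then 0 else phi k (exp_phi k f (n - 1)))"
proof -
  let ?D = "\<lambda>i. inverse (\<iota> (carlitz_D i))"
  have D: "?D i * \<theta> ^ (CARD('q) ^ i) = \<theta> * ?D i + (if i = 0 then 0 else ?D (i - 1) ^ CARD('q))" for i
  proof (cases i)
    case (Suc j)
    have nz: "\<iota> (carlitz_D i) \<noteq> 0" "\<iota> (carlitz_D j) \<noteq> 0" by (simp_all add: carlitz_D_nonzero)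
    have eq: "\<iota> (carlitz_D i) = (\<theta> ^ (CARD('q) ^ i) - \<theta>) * \<iota> (carlitz_D j) ^ CARD('q)"
      unfolding Suc by (simp only: carlitz_D.simps iota_mult iota_diff iota_power)
    have "?D i * (\<theta> ^ (CARD('q) ^ i) - \<theta>) = ?D j ^ CARD('q)"
      using nz unfolding eq by (simp add: field_simps)
    thus ?thesis using Suc by (simp add: algebra_simps)
  qed simp
  have "exp_phi k (\<lambda>n. mconst \<theta> * f n) n
          = (\<Sum>i\<le>n. mconst (?D i * \<theta> ^ (CARD('q) ^ i)) * (phi k ^^ i) (f (n - i)))"
    by (simp add: exp_phi_def phi_pow_mconst_mult mconst_mult mult.assoc)
  also have "\<dots> = (\<Sum>i\<le>n. mconst \<theta> * (mconst (?D i) * (phi k ^^ i) (f (n - i))))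
                + (\<Sum>i\<le>n. if i = 0 then 0 else mconst (?D (i - 1) ^ CARD('q)) * (phi k ^^ i) (f (n - i)))"
    unfolding D sum.distrib[symmetric]
    by (intro sum.cong refl) (simp add: mconst_add mconst_mult algebra_simps)
  also have "(\<Sum>i\<le>n. mconst \<theta> * (mconst (?D i) * (phi k ^^ i) (f (n - i)))) = mconst \<theta> * exp_phi k f n"
    by (simp add: exp_phi_def sum_distrib_left)
  also have "(\<Sum>i\<le>n. if i = 0 then 0 else mconst (?D (i - 1) ^ CARD('q)) * (phi k ^^ i) (f (n - i)))
               = (if n = 0 then 0 else phi k (exp_phi k f (n - 1)))"
  proof (cases n)
    case (Suc m)
    show ?thesis unfolding Suc sum.atMost_Suc_shift by (simp add: exp_phi_def phi_sum phi_mconst_mult)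
  qed simp
  finally show ?thesis .
qed

text \<open>
  The functional equation \<open>exp\<^sub>C(a G) = C\<^sub>a(exp\<^sub>C(G))\<close>, by the
  Horner scheme for \<open>a\<close>.
\<close>

lemma exp_phi_mult:
  "exp_phi k (\<lambda>n. mconst (\<iota> a) * f n) n
     = (\<Sum>j\<le>n. mconst (\<iota> (carlitz_coeff a j)) * (phi k ^^ j) (exp_phi k f (n - j)))"
proof (induction a arbitrary: n)
  case 0
  show ?case by (simp add: exp_phi_def)
next
  case (pCons c a)
  let ?E = "\<lambda>j. (phi k ^^ j) (exp_phi k f (n - j))" and ?c = "\<lambda>j. carlitz_coeff a j"
  have "mconst (\<iota> (pCons c a)) * f n = mconst (\<iota> [:c:]) * f n + mconst \<theta> * (mconst (\<iota> a) * f n)" for n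
    unfolding pCons_eq_const_plus_theta[of c a] iota_add iota_mult mconst_add mconst_mult
    by (simp add: algebra_simps)
  hence "exp_phi k (\<lambda>n. mconst (\<iota> (pCons c a)) * f n) n
          = mconst (\<iota> [:c:]) * exp_phi k f n + mconst \<theta> * (\<Sum>j\<le>n. mconst (\<iota> (?c j)) * ?E j)
            + (if n = 0 then 0 else phi k (\<Sum>j\<le>n - 1. mconst (\<iota> (?c j)) * (phi k ^^ j) (exp_phi k f (n - 1 - j))))"
    by (simp add: exp_phi_add exp_phi_const_mult exp_phi_theta_mult pCons.IH)
  also have "(if n = 0 then 0 else phi k (\<Sum>j\<le>n - 1. mconst (\<iota> (?c j)) * (phi k ^^ j) (exp_phi k f (n - 1 - j))))
               = (\<Sum>j\<le>n. if j = 0 then 0 else mconst (\<iota> (?c (j - 1) ^ CARD('q))) * ?E j)"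
  proof (cases n)
    case (Suc m)
    show ?thesis unfolding Suc sum.atMost_Suc_shift by (simp add: phi_sum phi_mconst_mult iota_power)
  qed simp
  also have "mconst (\<iota> [:c:]) * exp_phi k f n = (\<Sum>j\<le>n. if j = 0 then mconst (\<iota> [:c:]) * ?E j else 0)"
    by simp
  also have "(\<Sum>j\<le>n. if j = 0 then mconst (\<iota> [:c:]) * ?E j else 0) + mconst \<theta> * (\<Sum>j\<le>n. mconst (\<iota> (?c j)) * ?E j)
                + (\<Sum>j\<le>n. if j = 0 then 0 else mconst (\<iota> (?c (j - 1) ^ CARD('q))) * ?E j)
              = (\<Sum>j\<le>n. mconst (\<iota> (carlitz_coeff (pCons c a) j)) * ?E j)"
    unfolding sum_distrib_left sum.distrib[symmetric]
  proof (intro sum.cong refl)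
    fix j
    show "(if j = 0 then mconst (\<iota> [:c:]) * ?E j else 0) + mconst \<theta> * (mconst (\<iota> (?c j)) * ?E j)
            + (if j = 0 then 0 else mconst (\<iota> (?c (j - 1) ^ CARD('q))) * ?E j)
          = mconst (\<iota> (carlitz_coeff (pCons c a) j)) * ?E j"
      unfolding carlitz_coeff_pCons iota_add iota_mult mconst_add mconst_mult
      by (cases j) (simp_all add: ring_distribs mult.assoc)
  qed
  finally show ?case .
qed

section \<open>Integrality at every prime\<close>

text \<open>
  Let \<open>S\<^sub>n\<close> denote \<open>harmonic_sum k c n\<close> and
  \<open>E\<^sub>n\<close> its exponential \<open>log_alg_coeff k c n\<close>.
\<close>

definition harmonic_sum :: "nat \<Rightarrow> 'q poly \<Rightarrow> nat \<Rightarrow> 'c mpol" where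
  "harmonic_sum k c n = (\<Sum>a | a \<in> A_plus \<and> degree a = n. mconst (\<iota> c * inverse (\<iota> a)) * A_poly_in_vars k a)"

definition log_alg_coeff :: "nat \<Rightarrow> 'q poly \<Rightarrow> nat \<Rightarrow> 'c mpol" where
  "log_alg_coeff k c = exp_phi k (harmonic_sum k c)"

lemma coeffs_in_max_ideal_diff:
  assumes "prime_elem P" "coeffs_in (max_ideal P) f" "coeffs_in (max_ideal P) g"
  shows "coeffs_in (max_ideal P) (f - g)"
proof -
  have "- x \<in> max_ideal P" if "x \<in> max_ideal P" for x
    using max_ideal_mult[OF assms(1) iota_in_localization[OF assms(1), of "-1"] that]
      iota_diff[of 0 1] by simp
  hence "coeffs_in (max_ideal P) (- g)" using assms(3) by (simp add: coeffs_in_def)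
  from coeffs_in_add[OF max_ideal_add[OF assms(1)] assms(2) this] show ?thesis by simp
qed

context
  fixes P :: "'q poly"
  assumes P: "prime_elem P" "lead_coeff P = 1" "degree P > 0"
begin

abbreviation "int_P \<equiv> coeffs_in (localization P)"
abbreviation "div_P \<equiv> coeffs_in (max_ideal P)"

lemma localization_1: "1 \<in> localization P"
  using iota_in_localization[OF P(1), of 1] by simp

lemma localization_power: "x \<in> localization P \<Longrightarrow> x ^ n \<in> localization P"
  by (induction n) (use localization_1 localization_mult[OF P(1)] in auto)

lemmas loc_0 = localization_0[OF P(1)]
lemmas loc_add = localization_add[OF P(1)]
lemmas loc_mult = localization_mult[OF P(1)]
lemmas mi_0 = max_ideal_0[OF P(1)]
lemmas mi_add = max_ideal_add[OF P(1)]

lemma int_P_mult: "int_P f \<Longrightarrow> int_P g \<Longrightarrow> int_P (f * g)"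
  by (rule coeffs_in_mult[OF loc_0 loc_add]) (auto intro: loc_mult simp: coeffs_in_def)

lemma int_P_prod: "(\<And>i. i \<in> S \<Longrightarrow> int_P (f i)) \<Longrightarrow> int_P (prod f S)"
  by (rule coeffs_in_prod[OF loc_0 localization_1 loc_add loc_mult])

lemma int_P_sum: "(\<And>i. i \<in> S \<Longrightarrow> int_P (f i)) \<Longrightarrow> int_P (sum f S)"
  by (rule coeffs_in_sum[OF loc_0 loc_add])

lemma div_P_add: "div_P f \<Longrightarrow> div_P g \<Longrightarrow> div_P (f + g)"
  by (rule coeffs_in_add[OF mi_add])

lemma div_P_sum: "(\<And>i. i \<in> S \<Longrightarrow> div_P (f i)) \<Longrightarrow> div_P (sum f S)"
  by (rule coeffs_in_sum[OF mi_0 mi_add])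

lemma div_P_mult: "int_P f \<Longrightarrow> div_P g \<Longrightarrow> div_P (f * g)"
  by (rule coeffs_in_mult[OF mi_0 mi_add])
     (auto intro: max_ideal_mult[OF P(1)] simp: coeffs_in_def)

lemma div_P_mconst_mult: "x \<in> max_ideal P \<Longrightarrow> int_P f \<Longrightarrow> div_P (mconst x * f)"
  by (rule coeffs_in_mconst_mult) (auto intro: max_ideal_mult'[OF P(1)] simp: coeffs_in_def)

lemma int_P_mconst_mult: "x \<in> localization P \<Longrightarrow> int_P f \<Longrightarrow> int_P (mconst x * f)"
  by (rule coeffs_in_mconst_mult) (auto intro: loc_mult simp: coeffs_in_def)

lemma int_P_cancel: "div_P (mconst (\<iota> P) * f) \<Longrightarrow> int_P f"
  using P(3) by (fastforce simp: coeffs_in_def lookup_mconst_mult max_ideal_def)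

lemma int_P_A_poly_in_var: "int_P (A_poly_in_var a v)"
  by (rule coeffs_in_A_poly_in_var[OF loc_0 loc_add iota_in_localization[OF P(1)]])

lemma int_P_A_poly_in_vars: "int_P (A_poly_in_vars k a)"
  unfolding A_poly_in_vars_def by (intro int_P_prod int_P_A_poly_in_var)

lemma int_P_twist: "int_P f \<Longrightarrow> int_P (twist CARD('q) f)"
  by (auto simp: coeffs_in_def lookup_twist intro: localization_power)

lemma int_P_theta_factor: "int_P (theta_factor v)"
  unfolding theta_factor_def
proof (rule coeffs_in_poly_in_var[OF loc_0 loc_add])
  have "- \<theta> \<in> localization P"
    using iota_in_localization[OF P(1), of "- [:0, 1:]"] iota_diff[of 0 "[:0, 1:]"] by simp
  thus "coeff [:- \<theta>, 1:] i \<in> localization P" for i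
    using localization_1 loc_0 by (auto simp: coeff_pCons split: nat.split)
qed

lemma int_P_basis_poly: "int_P (basis_poly j v)"
proof (induction j)
  case 0
  show ?case using loc_0 localization_1 by (simp add: coeffs_in_def lookup_one when_def)
qed (simp add: int_P_mult int_P_theta_factor int_P_twist)

lemma int_P_phi_pow: "int_P f \<Longrightarrow> int_P ((phi k ^^ i) f)"
  by (induction i) (auto simp: phi_def intro!: int_P_mult int_P_prod int_P_theta_factor int_P_twist)

lemma div_P_prod_diff:
  assumes "finite S" "\<And>v. v \<in> S \<Longrightarrow> int_P (f v)" "\<And>v. v \<in> S \<Longrightarrow> int_P (g v)"
    "\<And>v. v \<in> S \<Longrightarrow> div_P (f v - g v)"
  shows "div_P (prod f S - prod g S)"
  using assms
proof (induction S rule: finite_induct)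
  case empty
  show ?case using mi_0 by (simp add: coeffs_in_def)
next
  case (insert x F)
  have "prod f (insert x F) - prod g (insert x F) = prod f F * (f x - g x) + g x * (prod f F - prod g F)"
    using insert(1,2) by (simp add: algebra_simps)
  also have "div_P \<dots>" using insert by (intro div_P_add div_P_mult int_P_prod) auto
  finally show ?case .
qed

text \<open>
  In the expansion of \<open>P(t\<^sub>v)\<close> in the basis polynomials all coefficients
  below the leading one are divisible by \<open>P\<close>.
\<close>

lemma div_P_basis_poly_minus_A_poly_in_var:
  "div_P (basis_poly (degree P) v - A_poly_in_var P v)"
proof -
  obtain d where d: "degree P = Suc d" using P(3) by (cases "degree P") auto
  have "A_poly_in_var P v = (\<Sum>j\<le>d. mconst (\<iota> (carlitz_coeff P j)) * basis_poly j v) + basis_poly (degree P) v"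
    using A_poly_in_var_expand[of P "degree P" v] carlitz_coeff_degree[of P] P(2) unfolding d
    by (simp flip: one_pCons)
  moreover have "div_P (\<Sum>j\<le>d. mconst (\<iota> (carlitz_coeff P j)) * basis_poly j v)"
    using d by (intro div_P_sum div_P_mconst_mult int_P_basis_poly iota_in_max_ideal P(1)
        prime_dvd_carlitz_coeff) auto
  moreover have "div_P 0" using mi_0 by (simp add: coeffs_in_def)
  ultimately show ?thesis using coeffs_in_max_ideal_diff[OF P(1), of 0] by simp
qed

lemma lookup_twist_pow: "Poly_Mapping.lookup ((twist CARD('q) ^^ i) f) m = Poly_Mapping.lookup f m ^ (CARD('q) ^ i)"
  by (induction i) (simp_all add: lookup_twist mult.commute flip: power_mult)

text \<open>
  Modulo \<open>P\<close>, the operator \<open>\<phi>\<^sup>d\<close> with \<open>d = deg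
  P\<close> is multiplication by \<open>P(t\<^sub>0) \<dots> P(t\<^bsub>k-1\<^esub>)\<close>:
  the twist \<open>\<tau>\<^sup>d\<close> is trivial by Fermat, and the product of basis
  polynomials in front of it has this value.
\<close>

lemma div_P_phi_pow_degree:
  assumes f: "int_P f"
  shows "div_P ((phi k ^^ degree P) f - A_poly_in_vars k P * f)"
proof -
  let ?B = "\<Prod>v<k. basis_poly (degree P) v" and ?tf = "(twist CARD('q) ^^ degree P) f"
  have "(phi k ^^ degree P) f - A_poly_in_vars k P * f = ?B * (?tf - f) + f * (?B - A_poly_in_vars k P)"
    unfolding phi_pow_eq by (simp add: algebra_simps)
  also have "div_P \<dots>"
  proof (intro div_P_add div_P_mult int_P_prod int_P_basis_poly f)
    show "div_P (?tf - f)"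
      using f localization_power_card_power_degree[OF P]
      by (simp add: coeffs_in_def lookup_minus lookup_twist_pow)
    show "div_P (?B - A_poly_in_vars k P)" unfolding A_poly_in_vars_def
      by (intro div_P_prod_diff int_P_basis_poly int_P_A_poly_in_var div_P_basis_poly_minus_A_poly_in_var) auto
  qed
  finally show ?thesis .
qed

definition coprime_harmonic_sum :: "nat \<Rightarrow> 'q poly \<Rightarrow> nat \<Rightarrow> 'c mpol" where
  "coprime_harmonic_sum k c n = (\<Sum>a | a \<in> A_plus \<and> degree a = n \<and> \<not> P dvd a.
     mconst (\<iota> c * inverse (\<iota> a)) * A_poly_in_vars k a)"

lemma int_P_coprime_harmonic_sum: "int_P (coprime_harmonic_sum k c n)"
  unfolding coprime_harmonic_sum_def
  by (intro int_P_sum int_P_mconst_mult int_P_A_poly_in_vars loc_mult iota_in_localization P(1)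
        inverse_iota_in_localization) auto

text \<open>
  The monic multiples of \<open>P\<close> of degree \<open>n\<close> are the \<open>P b\<close>
  with \<open>b\<close> monic of degree \<open>n - deg P\<close>, and both \<open>a \<mapsto>
  a(t\<^sub>0) \<dots> a(t\<^bsub>k-1\<^esub>)\<close> and \<open>a \<mapsto> 1/a\<close> are
  multiplicative.
\<close>

lemma harmonic_sum_split:
  "mconst (\<iota> P) * harmonic_sum k c n = mconst (\<iota> P) * coprime_harmonic_sum k c n
     + (if degree P \<le> n then A_poly_in_vars k P * harmonic_sum k c (n - degree P) else 0)"
proof -
  let ?f = "\<lambda>a. mconst (\<iota> c * inverse (\<iota> a)) * A_poly_in_vars k a"
  let ?M = "{a. a \<in> A_plus \<and> degree a = n \<and> \<not> P dvd a}" and ?D = "{a. a \<in> A_plus \<and> degree a = n \<and> P dvd a}"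
  have nz: "P \<noteq> 0" using P(3) by auto
  have fin: "finite ?M" "finite ?D"
    by (rule finite_subset[OF _ finite_A_plus_degree[of n]], force)+
  have un: "{a. a \<in> A_plus \<and> degree a = n} = ?M \<union> ?D" by auto
  have split: "harmonic_sum k c n = coprime_harmonic_sum k c n + sum ?f ?D"
    unfolding harmonic_sum_def coprime_harmonic_sum_def un
    by (rule sum.union_disjoint) (use fin in auto)
  have "mconst (\<iota> P) * sum ?f ?D = (if degree P \<le> n then A_poly_in_vars k P * harmonic_sum k c (n - degree P) else 0)"
  proof (cases "degree P \<le> n")
    case False
    have "?D = {}" using False dvd_imp_degree_le[of P] by (fastforce simp: A_plus_def)
    hence "sum ?f ?D = 0" by (simp only: sum.empty)
    thus ?thesis using False by simp
  next
    case True
    have D: "?D = (*) P ` {b. b \<in> A_plus \<and> degree b = n - degree P}"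
    proof (intro equalityI subsetI)
      fix a assume a: "a \<in> ?D"
      then obtain b where b: "a = P * b" by auto
      have "b \<noteq> 0" using a b by (auto simp: A_plus_def)
      hence "degree b = n - degree P" using a nz by (auto simp: b degree_mult_eq)
      moreover have "lead_coeff b = 1" using a P(2) by (simp add: b A_plus_def lead_coeff_mult)
      ultimately show "a \<in> (*) P ` {b. b \<in> A_plus \<and> degree b = n - degree P}"
        using b by (auto simp: A_plus_def)
    next
      fix a assume "a \<in> (*) P ` {b. b \<in> A_plus \<and> degree b = n - degree P}"
      then obtain b where b': "a = P * b" "b \<in> A_plus" "degree b = n - degree P" by blast
      hence b: "a = P * b" "lead_coeff b = 1" "degree b = n - degree P" by (auto simp: A_plus_def)
      have "b \<noteq> 0" using b(2) by auto
      hence "degree a = n" using True nz by (simp add: b degree_mult_eq)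
      moreover have "lead_coeff a = 1" unfolding b(1) lead_coeff_mult b(2) P(2) by simp
      ultimately show "a \<in> ?D" using b(1) by (simp add: A_plus_def)
    qed
    have "sum ?f ?D = (\<Sum>b | b \<in> A_plus \<and> degree b = n - degree P. ?f (P * b))"
      unfolding D by (rule sum.reindex_cong[of "(*) P"]) (use nz in \<open>auto simp: inj_on_def\<close>)
    moreover have "mconst (\<iota> P) * ?f (P * b) = A_poly_in_vars k P * ?f b" for b
    proof -
      have "\<iota> c * inverse (\<iota> b) = \<iota> P * (\<iota> c * inverse (\<iota> (P * b)))"
        using nz by (simp add: iota_mult)
      hence "mconst (\<iota> c * inverse (\<iota> b)) = mconst (\<iota> P) * mconst (\<iota> c * inverse (\<iota> (P * b)))"
        by (simp only: mconst_mult)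
      thus ?thesis by (simp only: A_poly_in_vars_mult mult_ac)
    qed
    ultimately have "mconst (\<iota> P) * sum ?f ?D
             = (\<Sum>b | b \<in> A_plus \<and> degree b = n - degree P. A_poly_in_vars k P * ?f b)"
      by (simp only: sum_distrib_left)
    thus ?thesis using True by (simp add: harmonic_sum_def sum_distrib_left)
  qed
  thus ?thesis by (simp add: split ring_distribs)
qed

lemma exp_phi_shift_A_poly_in_vars:
  "exp_phi k (\<lambda>n. if d \<le> n then A_poly_in_vars k a * f (n - d) else 0) n
     = (if d \<le> n then A_poly_in_vars k a * exp_phi k f (n - d) else 0)"
proof (cases "d \<le> n")
  case True
  let ?D = "\<lambda>i. mconst (inverse (\<iota> (carlitz_D i)))"
  have "exp_phi k (\<lambda>n. if d \<le> n then A_poly_in_vars k a * f (n - d) else 0) n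
          = (\<Sum>i\<le>n - d. ?D i * (phi k ^^ i) (if d \<le> n - i then A_poly_in_vars k a * f (n - i - d) else 0))"
    unfolding exp_phi_def by (rule sum.mono_neutral_right) (use True in auto)
  also have "\<dots> = (\<Sum>i\<le>n - d. A_poly_in_vars k a * (?D i * (phi k ^^ i) (f (n - d - i))))"
    using True by (intro sum.cong refl) (auto simp: phi_pow_A_poly_in_vars_mult mult.left_commute add.commute)
  finally show ?thesis using True by (simp add: exp_phi_def sum_distrib_left)
qed (auto simp: exp_phi_def intro!: sum.neutral)

text \<open>
  The exponential of \<open>P f\<close> has the denominators \<open>D\<^sub>i\<close>
  compensated by the factors \<open>P\<^bsup>q^i\<^esup>\<close> that semilinearity produces.
\<close>

lemma div_P_exp_phi_mult:
  assumes "\<And>n. int_P (f n)"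
  shows "div_P (exp_phi k (\<lambda>n. mconst (\<iota> P) * f n) n)"
proof -
  have "exp_phi k (\<lambda>n. mconst (\<iota> P) * f n) n
          = (\<Sum>i\<le>n. mconst (\<iota> P ^ (CARD('q) ^ i) * inverse (\<iota> (carlitz_D i))) * (phi k ^^ i) (f (n - i)))"
    by (simp add: exp_phi_def phi_pow_mconst_mult mconst_mult mult.assoc mult.left_commute)
  also have "div_P \<dots>"
    by (intro div_P_sum div_P_mconst_mult int_P_phi_pow assms prime_power_div_carlitz_D P(1))
  finally show ?thesis .
qed

text \<open>
  Computing the exponential of \<open>P S\<close> once by \<open>harmonic_sum_split\<close> and
  once by the functional equation gives, with \<open>d = deg P\<close>, \<open>P E\<^sub>n =
  exp(P H)\<^sub>n - \<Sum>\<^bsub>j=1..n\<^esub> ([P, j] \<phi>\<^sup>j(E\<^bsub>n-j\<^esub>)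
  - \<delta>\<^bsub>j,d\<^esub> P(t\<^sub>0) \<dots> P(t\<^bsub>k-1\<^esub>)
  E\<^bsub>n-d\<^esub>)\<close>. By induction all \<open>E\<close> on the right are integral at
  \<open>P\<close>, and then every term there is divisible by \<open>P\<close>: for \<open>j <
  d\<close> because of \<open>[P, j]\<close>, for \<open>j = d\<close> because of
  \<open>div_P_phi_pow_degree\<close>, for \<open>j > d\<close> because of \<open>[P, j] = 0\<close>.
\<close>

lemma int_P_log_alg_coeff: "int_P (log_alg_coeff k c n)"
proof (induction n rule: less_induct)
  case (less n)
  let ?E = "log_alg_coeff k c" and ?d = "degree P"
  let ?T = "\<lambda>j. mconst (\<iota> (carlitz_coeff P j)) * (phi k ^^ j) (?E (n - j))"
  let ?U = "\<lambda>j. if j = ?d then A_poly_in_vars k P * ?E (n - j) else 0"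
  let ?H = "exp_phi k (\<lambda>n. mconst (\<iota> P) * coprime_harmonic_sum k c n) n"
  have "exp_phi k (\<lambda>n. mconst (\<iota> P) * harmonic_sum k c n) n = ?H + (if ?d \<le> n then A_poly_in_vars k P * ?E (n - ?d) else 0)"
    unfolding harmonic_sum_split exp_phi_add exp_phi_shift_A_poly_in_vars log_alg_coeff_def ..
  also have "(if ?d \<le> n then A_poly_in_vars k P * ?E (n - ?d) else 0) = (\<Sum>j=1..n. ?U j)"
    using P(3) by simp
  finally have "(\<Sum>j\<le>n. ?T j) = ?H + (\<Sum>j=1..n. ?U j)"
    unfolding exp_phi_mult log_alg_coeff_def .
  moreover have "(\<Sum>j\<le>n. ?T j) = mconst (\<iota> P) * ?E n + (\<Sum>j=1..n. ?T j)"
    by (simp add: atMost_atLeast0 sum.atLeast_Suc_atMost)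
  ultimately have "mconst (\<iota> P) * ?E n = ?H - (\<Sum>j=1..n. ?T j - ?U j)"
    by (simp add: sum_subtractf algebra_simps)
  also have "div_P \<dots>"
  proof (rule coeffs_in_max_ideal_diff[OF P(1)])
    show "div_P ?H" by (intro div_P_exp_phi_mult int_P_coprime_harmonic_sum)
    show "div_P (\<Sum>j=1..n. ?T j - ?U j)"
    proof (rule div_P_sum)
      fix j assume "j \<in> {1..n}"
      hence IH: "int_P (?E (n - j))" by (intro less.IH) auto
      consider "j < ?d" | "j = ?d" | "j > ?d" by linarith
      thus "div_P (?T j - ?U j)"
      proof cases
        case 1
        hence "div_P (?T j)"
          by (intro div_P_mconst_mult int_P_phi_pow IH iota_in_max_ideal P(1) prime_dvd_carlitz_coeff)
        thus ?thesis using 1 by simp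
      next
        case 2
        hence "carlitz_coeff P j = 1" using carlitz_coeff_degree[of P] P(2) by (simp flip: one_pCons)
        thus ?thesis using div_P_phi_pow_degree[OF IH, of k] 2 by simp
      next
        case 3
        hence "carlitz_coeff P j = 0" by (rule carlitz_coeff_eq_0)
        thus ?thesis using 3 mi_0 by (simp add: coeffs_in_def)
      qed
    qed
  qed
  finally show ?case by (rule int_P_cancel)
qed

end

lemma log_alg_coeff_in_A: "coeffs_in (range \<iota>) (log_alg_coeff k c n)"
  unfolding coeffs_in_def
proof
  fix m
  show "Poly_Mapping.lookup (log_alg_coeff k c n) m \<in> range \<iota>"
    by (rule in_range_iota_if_in_localizations)
       (use int_P_log_alg_coeff in \<open>auto simp: coeffs_in_def\<close>)
qed

section \<open>Vanishing in high degree\<close>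

lemma absv_mult: "absv (x * y) = absv x * absv y"
  by (rule dist_mult_0)

lemma absv_1: "absv 1 = 1"
  using absv_iota[of 1] by simp

lemma absv_power: "absv (x ^ n) = absv x ^ n"
  by (induction n) (simp_all add: absv_1 absv_mult)

lemma absv_inverse: "absv (inverse x) = inverse (absv x)"
proof (cases "x = 0")
  case False
  hence "absv x * absv (inverse x) = 1" by (simp add: absv_1 flip: absv_mult)
  thus ?thesis using inverse_unique by metis
qed simp

definition closed_ball :: "real \<Rightarrow> 'c set" where
  "closed_ball r = {x. absv x \<le> r}"

lemma closed_ball_0: "r \<ge> 0 \<Longrightarrow> 0 \<in> closed_ball r"
  by (simp add: closed_ball_def)

lemma closed_ball_add: "x \<in> closed_ball r \<Longrightarrow> y \<in> closed_ball r \<Longrightarrow> x + y \<in> closed_ball r"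
  using dist_ultra[of x y] by (auto simp: closed_ball_def)

lemma closed_ball_mult:
  assumes "x \<in> closed_ball r" "y \<in> closed_ball r'"
  shows "x * y \<in> closed_ball (r * r')"
  using assms order_trans[OF zero_le_dist[of x 0]]
  by (auto simp: closed_ball_def absv_mult intro!: mult_mono)

lemma absv_const: "absv (\<iota> [:c:]) \<le> 1"
  using absv_iota[of "[:c:]"] by (cases "c = 0") auto

lemma bounded_mult:
  fixes f g :: "'c mpol"
  assumes "0 \<le> r" "0 \<le> r'" "coeffs_in (closed_ball r) f" "coeffs_in (closed_ball r') g"
  shows "coeffs_in (closed_ball (r * r')) (f * g)"
  using assms by (intro coeffs_in_mult closed_ball_0 closed_ball_add closed_ball_mult) (auto simp: coeffs_in_def)

lemma bounded_prod:
  fixes f :: "nat \<Rightarrow> 'c mpol"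
  assumes "0 \<le> r" "\<And>v. coeffs_in (closed_ball r) (f v)"
  shows "coeffs_in (closed_ball (r ^ k)) (\<Prod>v<k. f v)"
proof (induction k)
  case 0
  show ?case by (simp add: coeffs_in_def lookup_one when_def closed_ball_def absv_1)
next
  case (Suc k)
  have "coeffs_in (closed_ball (r ^ k * r)) ((\<Prod>v<k. f v) * f k)"
    by (rule bounded_mult[OF zero_le_power[OF assms(1)] assms(1) Suc assms(2)])
  thus ?case by (simp add: mult.commute)
qed

lemma bounded_A_poly_in_vars: "coeffs_in (closed_ball 1) (A_poly_in_vars k a)"
proof -
  have "coeffs_in (closed_ball 1) (A_poly_in_var a v)" for v
    by (intro coeffs_in_A_poly_in_var closed_ball_0 closed_ball_add)
       (simp_all add: closed_ball_def absv_const)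
  from bounded_prod[OF _ this, of k] show ?thesis by (simp add: A_poly_in_vars_def)
qed

lemma bounded_theta_factor: "coeffs_in (closed_ball (real CARD('q))) (theta_factor v)"
  unfolding theta_factor_def
proof (intro coeffs_in_poly_in_var closed_ball_0 closed_ball_add)
  have "absv (- \<theta>) = real CARD('q)"
    using absv_iota[of "- [:0, 1:]"] iota_diff[of 0 "[:0, 1:]"] by simp
  thus "coeff [:- \<theta>, 1:] i \<in> closed_ball (real CARD('q))" for i
    using q_gt_1 by (auto simp: coeff_pCons closed_ball_def absv_1 split: nat.split)
qed auto

lemma bounded_phi:
  assumes "0 \<le> r" "coeffs_in (closed_ball r) f"
  shows "coeffs_in (closed_ball (real CARD('q) ^ k * r ^ CARD('q))) (phi k f)"
  unfolding phi_def
proof (rule bounded_mult)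
  show "coeffs_in (closed_ball (real CARD('q) ^ k)) (\<Prod>v<k. theta_factor v)"
    by (intro bounded_prod bounded_theta_factor) simp
  show "coeffs_in (closed_ball (r ^ CARD('q))) (twist CARD('q) f)"
    using assms by (auto simp: coeffs_in_def lookup_twist closed_ball_def absv_power intro: power_mono)
qed (use assms in auto)

text \<open>
  The exact exponent of \<open>q\<close> is \<open>k (1 + q + \<dots> +
  q\<^bsup>i-1\<^esup>)\<close>. The coarser \<open>k (q\<^sup>i - 1)\<close> has no sum in it
  and is still reproduced by the induction step.
\<close>

lemma bounded_phi_pow:
  assumes "0 \<le> r" "coeffs_in (closed_ball r) f"
  shows "coeffs_in (closed_ball (real CARD('q) ^ (k * (CARD('q) ^ i - 1)) * r ^ (CARD('q) ^ i))) ((phi k ^^ i) f)"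
proof (induction i)
  case (Suc i)
  let ?q = "CARD('q)" and ?Q = "real CARD('q)"
  define N where "N = ?q ^ i"
  have N: "N \<ge> 1" using q_gt_1 by (simp add: N_def)
  have "coeffs_in (closed_ball (?Q ^ k * (?Q ^ (k * (N - 1)) * r ^ N) ^ ?q)) ((phi k ^^ Suc i) f)"
    using bounded_phi[OF _ Suc] assms(1) by (simp add: N_def)
  moreover have "?Q ^ k * (?Q ^ (k * (N - 1)) * r ^ N) ^ ?q = ?Q ^ (k + k * (N - 1) * ?q) * r ^ (?q * N)"
    by (simp add: power_mult_distrib power_add mult.commute flip: power_mult)
  moreover have "?Q ^ (k + k * (N - 1) * ?q) * r ^ (?q * N) \<le> ?Q ^ (k * (?q * N - 1)) * r ^ (?q * N)"
  proof (intro mult_right_mono power_increasing)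
    obtain M where "N = Suc M" using N by (cases N) auto
    moreover have "k + k * M * ?q = k * (1 + M * ?q)" by (simp add: algebra_simps)
    moreover have "k * (1 + M * ?q) \<le> k * (?q * Suc M - 1)"
      using q_gt_1 by (intro mult_left_mono) (auto simp: algebra_simps)
    ultimately show "k + k * (N - 1) * ?q \<le> k * (?q * N - 1)" by simp
  qed (use assms(1) q_gt_1 in auto)
  ultimately show ?case
    by (auto elim!: coeffs_in_mono simp: closed_ball_def N_def)
qed (use assms in simp)

lemma bounded_harmonic_sum:
  "coeffs_in (closed_ball (real CARD('q) ^ degree c / real CARD('q) ^ n)) (harmonic_sum k c n)"
  unfolding harmonic_sum_def
proof (intro coeffs_in_sum closed_ball_0 closed_ball_add)
  fix a :: "'q poly" assume a: "a \<in> {a. a \<in> A_plus \<and> degree a = n}"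
  hence nz: "a \<noteq> 0" by (auto simp: A_plus_def)
  have "absv (\<iota> c) \<le> real CARD('q) ^ degree c"
    using absv_iota[of c] by (cases "c = 0") auto
  hence "absv (\<iota> c * inverse (\<iota> a)) \<le> real CARD('q) ^ degree c / real CARD('q) ^ n"
    using a absv_iota[OF nz] by (simp add: absv_mult absv_inverse divide_inverse mult_right_mono)
  moreover have "absv (Poly_Mapping.lookup (A_poly_in_vars k a) m) \<le> 1" for m
    using bounded_A_poly_in_vars[of k a] by (simp add: coeffs_in_def closed_ball_def)
  ultimately show "coeffs_in (closed_ball (real CARD('q) ^ degree c / real CARD('q) ^ n))
      (mconst (\<iota> c * inverse (\<iota> a)) * A_poly_in_vars k a)"
    by (intro coeffs_in_mconst_mult)
       (metis closed_ball_def mem_Collect_eq closed_ball_mult mult_1_right)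
qed auto

text \<open>
  The \<open>i\<close>-th term is at most \<open>q\<^bsup>- i N\<^esup> q\<^bsup>k N\<^esup>
  (q\<^bsup>deg c - n + i\<^esup>)\<^sup>N = (q\<^bsup>k + deg c - n\<^esup>)\<^sup>N\<close>
  with \<open>N = q\<^sup>i\<close>. The absolute value of \<open>D\<^sub>i\<close> exactly
  cancels the loss from \<open>S\<^bsub>n-i\<^esub>\<close> being larger than
  \<open>S\<^sub>n\<close>.
\<close>

lemma bounded_log_alg_coeff:
  assumes "k + degree c \<le> n"
  shows "coeffs_in (closed_ball (real CARD('q) ^ (k + degree c) / real CARD('q) ^ n)) (log_alg_coeff k c n)"
  unfolding log_alg_coeff_def exp_phi_def
proof (intro coeffs_in_sum closed_ball_0 closed_ball_add)
  let ?q = "CARD('q)" and ?Q = "real CARD('q)"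
  have Q: "?Q > 1" using q_gt_1 by simp
  define r where "r = ?Q ^ (k + degree c) / ?Q ^ n"
  have r: "0 \<le> r" "r \<le> 1" using assms Q by (auto simp: r_def power_increasing)
  fix i assume i: "i \<in> {..n}"
  define N where "N = ?q ^ i"
  have N: "N \<ge> 1" using q_gt_1 by (simp add: N_def)
  let ?s = "?Q ^ degree c / ?Q ^ (n - i)"
  have "coeffs_in (closed_ball (?Q ^ (k * (N - 1)) * ?s ^ N)) ((phi k ^^ i) (harmonic_sum k c (n - i)))"
    unfolding N_def by (intro bounded_phi_pow bounded_harmonic_sum) auto
  moreover have "inverse (\<iota> (carlitz_D i)) \<in> closed_ball (inverse (?Q ^ (i * N)))"
    by (simp add: closed_ball_def absv_inverse absv_iota carlitz_D_nonzero degree_carlitz_D N_def)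
  ultimately have "coeffs_in (closed_ball (inverse (?Q ^ (i * N)) * (?Q ^ (k * (N - 1)) * ?s ^ N)))
        (mconst (inverse (\<iota> (carlitz_D i))) * (phi k ^^ i) (harmonic_sum k c (n - i)))"
    by (intro coeffs_in_mconst_mult closed_ball_mult) (auto simp: coeffs_in_def)
  moreover have "inverse (?Q ^ (i * N)) * (?Q ^ (k * (N - 1)) * ?s ^ N) \<le> r"
  proof -
    have "inverse (?Q ^ (i * N)) * (?Q ^ (k * (N - 1)) * ?s ^ N) \<le> inverse (?Q ^ (i * N)) * (?Q ^ (k * N) * ?s ^ N)"
      using Q by (intro mult_left_mono mult_right_mono power_increasing) auto
    also have "\<dots> = (?Q ^ k * ?s / ?Q ^ i) ^ N"
      by (simp add: power_mult_distrib power_divide power_mult divide_inverse power_inverse)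
    also have "?Q ^ k * ?s / ?Q ^ i = r"
      using i Q by (simp add: r_def power_add field_simps flip: power_add)
    also have "r ^ N \<le> r ^ 1" using N r by (intro power_decreasing) auto
    finally show ?thesis by simp
  qed
  ultimately show "coeffs_in (closed_ball (?Q ^ (k + degree c) / ?Q ^ n))
        (mconst (inverse (\<iota> (carlitz_D i))) * (phi k ^^ i) (harmonic_sum k c (n - i)))"
    unfolding r_def[symmetric] by (auto elim!: coeffs_in_mono simp: closed_ball_def)
qed auto

lemma log_alg_coeff_eq_0:
  assumes "k + degree c < n"
  shows "log_alg_coeff k c n = 0"
proof (rule poly_mapping_eqI)
  fix m
  let ?x = "Poly_Mapping.lookup (log_alg_coeff k c n) m"
  obtain a where a: "?x = \<iota> a" using log_alg_coeff_in_A[of k c n] unfolding coeffs_in_def by blast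
  have "absv ?x \<le> real CARD('q) ^ (k + degree c) / real CARD('q) ^ n"
    using bounded_log_alg_coeff[of k c n] assms by (simp add: coeffs_in_def closed_ball_def)
  also have "\<dots> < 1" using assms q_gt_1 by (simp add: power_strict_increasing)
  finally have "absv (\<iota> a) < 1" by (simp add: a)
  moreover have "1 \<le> real CARD('q) ^ degree a" using q_gt_1 by (intro one_le_power) simp
  ultimately have "a = 0" using absv_iota[of a] by (metis not_le)
  thus "?x = Poly_Mapping.lookup 0 m" using a by simp
qed

end

section \<open>Formal power series and monomials\<close>

lemma fps_sums_of_vanishing_orders:
  fixes f :: "nat \<Rightarrow> 'r::comm_ring_1 fps"
  assumes "\<And>i n. n < i \<Longrightarrow> fps_nth (f i) n = 0"
  shows "f sums Abs_fps (\<lambda>n. \<Sum>i\<le>n. fps_nth (f i) n)"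
  unfolding sums_def
proof (rule tendsto_fpsI)
  fix n
  show "eventually (\<lambda>N. fps_nth (\<Sum>i<N. f i) n = fps_nth (Abs_fps (\<lambda>n. \<Sum>i\<le>n. fps_nth (f i) n)) n)
          sequentially"
    using eventually_gt_at_top[of n]
  proof eventually_elim
    case (elim N)
    have "(\<Sum>i<N. fps_nth (f i) n) = (\<Sum>i\<le>n. fps_nth (f i) n)"
      by (rule sum.mono_neutral_right) (use elim assms in auto)
    thus ?case by (simp add: fps_sum_nth)
  qed
qed

text \<open>
  The freshman's dream holds for infinite sums, because up to degree \<open>N\<close> only
  finitely many terms of \<open>G\<close> matter.
\<close>

lemma fps_nth_power_card_power:
  fixes G :: "'r::comm_ring_1 fps"
  assumes "CHAR('r) = CHAR('q::finite_field)"
  shows "fps_nth (G ^ (CARD('q) ^ i)) N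
           = (if CARD('q) ^ i dvd N then fps_nth G (N div CARD('q) ^ i) ^ (CARD('q) ^ i) else 0)"
proof -
  define Q where "Q = CARD('q) ^ i"
  have Q: "Q > 0" by (simp add: Q_def)
  have char: "CHAR('r fps) = CHAR('q)" using assms by simp
  define T where "T = (\<Sum>n\<le>N. fps_const (fps_nth G n) * fps_X ^ n)"
  define R where "R = fps_shift (Suc N) G"
  have G: "G = T + fps_X ^ Suc N * R"
  proof (rule fps_ext)
    fix n
    have "fps_nth T n = (\<Sum>m\<le>N. if n = m then fps_nth G m else 0)"
      unfolding T_def fps_sum_nth by (intro sum.cong refl) (simp add: fps_X_power_nth)
    thus "fps_nth G n = fps_nth (T + fps_X ^ Suc N * R) n"
      by (auto simp: fps_X_power_mult_nth R_def simp del: power_Suc)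
  qed
  have "G ^ Q = T ^ Q + fps_X ^ (Suc N * Q) * R ^ Q"
    unfolding Q_def by (subst G, subst add_power_card_power[OF char])
      (simp only: power_mult_distrib power_mult)
  moreover have "N < Suc N * Q" using Q by (cases Q) auto
  ultimately have "fps_nth (G ^ Q) N = fps_nth (T ^ Q) N"
    by (simp add: fps_X_power_mult_nth del: mult_Suc)
  also have "T ^ Q = (\<Sum>n\<le>N. fps_const (fps_nth G n ^ Q) * fps_X ^ (n * Q))"
    unfolding T_def Q_def sum_power_card_power[OF char]
    by (simp add: power_mult_distrib power_mult fps_const_power)
  also have "fps_nth \<dots> N = (\<Sum>n\<le>N. if N = n * Q then fps_nth G n ^ Q else 0)"
    unfolding fps_sum_nth by (intro sum.cong refl) (simp add: fps_X_power_nth)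
  also have "\<dots> = (if Q dvd N then fps_nth G (N div Q) ^ Q else 0)"
  proof (cases "Q dvd N")
    case True
    then obtain m where m: "N = m * Q" by (metis dvd_div_mult_self)
    have "(\<Sum>n\<le>N. if N = n * Q then fps_nth G n ^ Q else 0) = (\<Sum>n\<le>N. if n = m then fps_nth G n ^ Q else 0)"
      using Q by (intro sum.cong) (auto simp: m)
    also have "\<dots> = fps_nth G m ^ Q" using Q by (simp add: m)
    finally show ?thesis using Q by (simp add: m)
  qed (auto intro!: sum.neutral)
  finally show ?thesis by (simp add: Q_def)
qed

text \<open>
  This writes a monomial as a product of single variables with repetition, chosen independently
  of the values \<open>y\<close>: every monomial is a specialization of one that is linear in
  each variable.
\<close>

lemma prod_power_as_prod_nth:
  assumes "finite S"
  shows "\<exists>xs. set xs \<subseteq> S \<and>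
    (\<forall>y :: 'a \<Rightarrow> 'r::comm_monoid_mult. (\<Prod>i\<in>S. y i ^ f i) = (\<Prod>j<length xs. y (xs ! j)))"
proof -
  have "\<exists>xs. set xs \<subseteq> S \<and> (\<forall>y :: 'a \<Rightarrow> 'r. (\<Prod>i\<in>S. y i ^ f i) = prod_list (map y xs))"
    using assms
  proof (induction S rule: finite_induct)
    case (insert x F)
    then obtain xs where "set xs \<subseteq> F" "\<forall>y :: 'a \<Rightarrow> 'r. (\<Prod>i\<in>F. y i ^ f i) = prod_list (map y xs)" by blast
    thus ?case using insert(1,2)
      by (intro exI[of _ "replicate (f x) x @ xs"]) (auto simp: prod_list_replicate)
  qed auto
  moreover have "prod_list ys = (\<Prod>j<length ys. ys ! j)" for ys :: "'r list"
    by (induction ys) (simp_all add: prod.lessThan_Suc_shift del: prod.lessThan_Suc)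
  ultimately show ?thesis by auto
qed

section \<open>Translation to the Carlitz module\<close>

context C_infinity
begin

lemma carlitz_at_hom:
  "carlitz_at emb (a + b) Y = carlitz_at emb a Y + carlitz_at emb b Y"
  "carlitz_at emb (smult c a) Y = mconst (\<iota> [:c:]) * carlitz_at emb a Y"
  "carlitz_at emb (pCons 0 a) Y = mconst \<theta> * carlitz_at emb a Y + carlitz_at emb a Y ^ CARD('q)"
  unfolding carlitz_at_def
  by (simp_all add: carlitz_add carlitz_smult carlitz_pCons pcompose_carlitz_theta
        poly_map_poly_hom_add poly_map_poly_hom_smult poly_map_poly_hom_power
        iota_add iota_mult mconst_add mconst_mult)

lemma carlitz_at_0 [simp]: "carlitz_at emb 0 Y = 0"
  using carlitz_at_hom(2)[of 0 0 Y] by simp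

lemma carlitz_at_sum: "carlitz_at emb (sum f S) Y = (\<Sum>x\<in>S. carlitz_at emb (f x) Y)"
  by (induction S rule: infinite_finite_induct) (simp_all add: carlitz_at_hom)

definition carlitz_slot :: "(nat \<Rightarrow> 'c mpol) \<Rightarrow> nat \<Rightarrow> nat \<Rightarrow> 'c mpol" where
  "carlitz_slot Y j e = carlitz_at emb (monom 1 e) (Y j)"

lemma shift_by_theta: "shift_by [:- \<theta>, 1:] (carlitz_slot Y j) e = carlitz_slot Y j e ^ CARD('q)"
  by (simp add: shift_by_def carlitz_slot_def monom_Suc carlitz_at_hom mconst_uminus)

lemma shift_by_const: "shift_by (map_poly (\<lambda>c. \<iota> [:c:]) a) (carlitz_slot Y j) 0 = carlitz_at emb a (Y j)"
proof -
  have "shift_by (map_poly (\<lambda>c. \<iota> [:c:]) a) (carlitz_slot Y j) 0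
          = (\<Sum>i\<le>degree a. mconst (\<iota> [:coeff a i:]) * carlitz_at emb (monom 1 i) (Y j))"
    by (simp add: shift_by_def degree_map_poly coeff_map_poly carlitz_slot_def)
  also have "\<dots> = carlitz_at emb (\<Sum>i\<le>degree a. monom (coeff a i) i) (Y j)"
    by (simp add: carlitz_at_sum smult_monom flip: carlitz_at_hom(2))
  finally show ?thesis by (simp add: poly_as_sum_of_monoms)
qed

text \<open>
  Multiplication by \<open>t\<^sub>j - \<theta>\<close> replaces
  \<open>C\<^bsub>\<theta>^e\<^esub>\<close> in the \<open>j\<close>-th slot by its
  \<open>q\<close>-th power, and the twist raises the coefficients to the \<open>q\<close>-th
  power. Together these are the Frobenius map of the target ring.
\<close>

lemma slot_eval_phi: "slot_eval k (carlitz_slot Y) (phi k f) = slot_eval k (carlitz_slot Y) f ^ CARD('q)"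
  unfolding phi_def theta_factor_def slot_eval_prod_poly_in_var_mult shift_by_theta
  by (rule slot_eval_twist[OF CHAR_eq])

lemma slot_eval_phi_pow:
  "slot_eval k (carlitz_slot Y) ((phi k ^^ i) f) = slot_eval k (carlitz_slot Y) f ^ (CARD('q) ^ i)"
  by (induction i) (simp_all add: slot_eval_phi mult.commute flip: power_mult)

lemma slot_eval_A_poly_in_vars:
  "slot_eval k (carlitz_slot Y) (A_poly_in_vars k a) = (\<Prod>j<k. carlitz_at emb a (Y j))"
proof -
  have "slot_eval k (carlitz_slot Y) (A_poly_in_vars k a)
          = slot_eval k (carlitz_slot Y) ((\<Prod>v<k. poly_in_var (map_poly (\<lambda>c. \<iota> [:c:]) a) v) * 1)"
    by (simp add: A_poly_in_vars_def A_poly_in_var_def)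
  thus ?thesis by (simp only: slot_eval_prod_poly_in_var_mult slot_eval_1 shift_by_const)
qed

lemma slot_eval_log_alg_coeff:
  "slot_eval k (carlitz_slot Y) (log_alg_coeff k c n)
     = (\<Sum>i\<le>n. mconst (inverse (\<iota> (carlitz_D i)))
          * slot_eval k (carlitz_slot Y) (harmonic_sum k c (n - i)) ^ (CARD('q) ^ i))"
  by (simp add: log_alg_coeff_def exp_phi_def slot_eval_sum slot_eval_mconst_mult slot_eval_phi_pow)

section \<open>Polynomials with coefficients in \<open>A\<close>\<close>

lemma A_mpol_iff:
  "p \<in> A_mpol emb s \<longleftrightarrow>
     (\<forall>m\<in>Poly_Mapping.keys p. Poly_Mapping.keys m \<subseteq> {1..s}) \<and> coeffs_in (range \<iota>) p"
  by (simp add: A_mpol_def coeffs_in_def)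

lemma range_iota_0: "0 \<in> range \<iota>"
  by (rule range_eqI[of _ _ 0]) simp

lemma range_iota_add: "x \<in> range \<iota> \<Longrightarrow> y \<in> range \<iota> \<Longrightarrow> x + y \<in> range \<iota>"
  by (auto simp flip: iota_add)

lemma range_iota_mult: "x \<in> range \<iota> \<Longrightarrow> y \<in> range \<iota> \<Longrightarrow> x * y \<in> range \<iota>"
  by (auto simp flip: iota_mult)

lemma A_mpol_single:
  assumes "Poly_Mapping.keys m \<subseteq> {1..s}" "c \<in> range \<iota>"
  shows "Poly_Mapping.single m c \<in> A_mpol emb s"
  using assms range_iota_0 by (auto simp: A_mpol_iff coeffs_in_def lookup_single when_def)

lemma A_mpol_mconst: "c \<in> range \<iota> \<Longrightarrow> mconst c \<in> A_mpol emb s"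
  unfolding mconst_def by (rule A_mpol_single) auto

lemma one_in_range_iota: "1 \<in> range \<iota>"
  by (rule range_eqI[of _ _ 1]) simp

lemma A_mpol_mvar: "i \<in> {1..s} \<Longrightarrow> mvar i \<in> A_mpol emb s"
  unfolding mvar_def by (rule A_mpol_single[OF _ one_in_range_iota]) auto

lemma A_mpol_add: "p \<in> A_mpol emb s \<Longrightarrow> r \<in> A_mpol emb s \<Longrightarrow> p + r \<in> A_mpol emb s"
  using keys_add[of p r] coeffs_in_add[OF range_iota_add] by (fastforce simp: A_mpol_iff)

lemma A_mpol_mult:
  assumes "p \<in> A_mpol emb s" "r \<in> A_mpol emb s"
  shows "p * r \<in> A_mpol emb s"
  unfolding A_mpol_iff
proof
  show "coeffs_in (range \<iota>) (p * r)"
    by (rule coeffs_in_mult[OF range_iota_0 range_iota_add range_iota_mult])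
       (use assms in \<open>auto simp: A_mpol_iff coeffs_in_def\<close>)
  show "\<forall>m\<in>Poly_Mapping.keys (p * r). Poly_Mapping.keys m \<subseteq> {1..s}"
  proof
    fix m assume "m \<in> Poly_Mapping.keys (p * r)"
    then obtain m1 m2 where m: "m = m1 + m2" "m1 \<in> Poly_Mapping.keys p" "m2 \<in> Poly_Mapping.keys r"
      using keys_mult[of p r] by blast
    have "Poly_Mapping.keys m1 \<subseteq> {1..s}" "Poly_Mapping.keys m2 \<subseteq> {1..s}"
      using m assms unfolding A_mpol_iff by blast+
    thus "Poly_Mapping.keys m \<subseteq> {1..s}" using keys_add[of m1 m2] m(1) by blast
  qed
qed

lemma A_mpol_0: "0 \<in> A_mpol emb s"
  using A_mpol_mconst[OF range_iota_0] by simp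

lemma A_mpol_sum:
  fixes f :: "'i \<Rightarrow> 'c mpol"
  assumes "\<And>x. x \<in> S \<Longrightarrow> f x \<in> A_mpol emb s"
  shows "sum f S \<in> A_mpol emb s"
  using assms
proof (induction S rule: infinite_finite_induct)
  case (insert x S)
  thus ?case by (simp add: A_mpol_add)
qed (simp_all add: A_mpol_0)

lemma A_mpol_prod:
  fixes f :: "'i \<Rightarrow> 'c mpol"
  assumes "\<And>x. x \<in> S \<Longrightarrow> f x \<in> A_mpol emb s"
  shows "prod f S \<in> A_mpol emb s"
  using assms
proof (induction S rule: infinite_finite_induct)
  case (insert x S)
  thus ?case by (simp add: A_mpol_mult)
qed (use A_mpol_mconst[OF one_in_range_iota, of s] in simp_all)

lemma A_mpol_carlitz_at: "Y \<in> A_mpol emb s \<Longrightarrow> carlitz_at emb a Y \<in> A_mpol emb s"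
proof -
  assume Y: "Y \<in> A_mpol emb s"
  have "poly (map_poly (\<lambda>b. mconst (\<iota> b)) p) Y \<in> A_mpol emb s" for p
    by (induction p) (auto simp: map_poly_pCons intro!: A_mpol_0 A_mpol_add A_mpol_mult A_mpol_mconst Y)
  thus ?thesis by (simp add: carlitz_at_def)
qed

lemma A_mpol_slot_eval:
  assumes "coeffs_in (range \<iota>) p" "\<And>j e. j < k \<Longrightarrow> G j e \<in> A_mpol emb s"
  shows "slot_eval k G p \<in> A_mpol emb s"
  unfolding slot_eval_def using assms
  by (intro A_mpol_sum A_mpol_mult A_mpol_mconst A_mpol_prod) (auto simp: coeffs_in_def)

section \<open>The coefficients of \<open>L(F, Z)\<close>\<close>

definition star_sum :: "'c mpol \<Rightarrow> nat \<Rightarrow> 'c mpol" where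
  "star_sum F d = (\<Sum>a | a \<in> A_plus \<and> degree a = d.
     mconst (inverse (\<iota> a)) * msubst (\<lambda>i. carlitz_at emb a (mvar i)) F)"

definition frakL_coeff :: "'c mpol \<Rightarrow> nat \<Rightarrow> 'c mpol" where
  "frakL_coeff F n = (\<Sum>i\<le>n. mconst (inverse (\<iota> (carlitz_D i))) * star_sum F (n - i) ^ (CARD('q) ^ i))"

lemma power_card_gt: "d < CARD('q) ^ d"
  using q_gt_1 by (simp add: power_gt_expt)

lemma
  shows fps_nth_frakL_power: "fps_nth (frakL emb F) (CARD('q) ^ n) = frakL_coeff F n"
    and fps_nth_frakL_other: "(\<nexists>n. N = CARD('q) ^ n) \<Longrightarrow> fps_nth (frakL emb F) N = 0"
proof -
  let ?q = "CARD('q)"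
  have char: "CHAR('c mpol) = CHAR('q)" using CHAR_mpol CHAR_eq by metis
  let ?g = "\<lambda>d. fps_const (star_sum F d) * fps_X ^ (?q ^ d)"
  define G where "G = suminf ?g"
  have "?g sums Abs_fps (\<lambda>n. \<Sum>i\<le>n. fps_nth (?g i) n)"
  proof (rule fps_sums_of_vanishing_orders)
    fix i n :: nat assume "n < i"
    hence "n \<noteq> ?q ^ i" using power_card_gt[of i] by simp
    thus "fps_nth (?g i) n = 0" by (simp add: fps_X_power_nth)
  qed
  hence G: "G = Abs_fps (\<lambda>n. \<Sum>i\<le>n. fps_nth (?g i) n)" unfolding G_def by (rule sums_unique[symmetric])
  have Gnth: "fps_nth G n = (\<Sum>d\<le>n. if n = ?q ^ d then star_sum F d else 0)" for n
    unfolding G fps_nth_Abs_fps by (intro sum.cong refl) (simp add: fps_X_power_nth)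
  have G_pow: "fps_nth G (?q ^ d) = star_sum F d" for d
  proof -
    have "fps_nth G (?q ^ d) = (\<Sum>d'\<le>?q ^ d. if d' = d then star_sum F d' else 0)"
      unfolding Gnth using q_gt_1 by (intro sum.cong refl) auto
    thus ?thesis using less_imp_le[OF power_card_gt[of d]] by simp
  qed
  have G_other: "fps_nth G n = 0" if "\<nexists>d. n = ?q ^ d" for n
    unfolding Gnth using that by (intro sum.neutral) auto
  let ?h = "\<lambda>i. fps_const (mconst (inverse (\<iota> (carlitz_D i)))) * G ^ (?q ^ i)"
  have hnth: "fps_nth (?h i) n = mconst (inverse (\<iota> (carlitz_D i)))
                * (if ?q ^ i dvd n then fps_nth G (n div ?q ^ i) ^ (?q ^ i) else 0)" for i n
    by (simp add: fps_nth_power_card_power[OF char])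
  have h_sums: "?h sums Abs_fps (\<lambda>n. \<Sum>i\<le>n. fps_nth (?h i) n)"
  proof (rule fps_sums_of_vanishing_orders)
    fix i n :: nat assume "n < i"
    hence "n < ?q ^ i" using power_card_gt[of i] by simp
    moreover have "fps_nth G 0 = 0" using q_gt_1 by (intro G_other) auto
    ultimately show "fps_nth (?h i) n = 0"
      unfolding hnth using dvd_imp_le[of "?q ^ i" n] by (cases "n = 0") (auto simp: zero_power)
  qed
  have "frakL emb F = suminf ?h"
    unfolding frakL_altdef exp_C_def G_def star_sum_def ..
  also have "\<dots> = Abs_fps (\<lambda>n. \<Sum>i\<le>n. fps_nth (?h i) n)"
    by (rule sums_unique[OF h_sums, symmetric])
  finally have L: "fps_nth (frakL emb F) N = (\<Sum>i\<le>N. fps_nth (?h i) N)" for N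
    by (simp only: fps_nth_Abs_fps)
  show "fps_nth (frakL emb F) (?q ^ n) = frakL_coeff F n"
  proof -
    have "fps_nth (frakL emb F) (?q ^ n) = (\<Sum>i\<le>n. fps_nth (?h i) (?q ^ n))"
      unfolding L
    proof (rule sum.mono_neutral_right)
      show "{..n} \<subseteq> {..?q ^ n}" using power_card_gt[of n] by auto
      show "\<forall>i\<in>{..?q ^ n} - {..n}. fps_nth (?h i) (?q ^ n) = 0"
      proof
        fix i assume "i \<in> {..?q ^ n} - {..n}"
        hence "\<not> ?q ^ i dvd ?q ^ n" using q_gt_1 power_dvd_imp_le[of ?q i n] by auto
        thus "fps_nth (?h i) (?q ^ n) = 0" unfolding hnth by simp
      qed
    qed simp
    also have "\<dots> = frakL_coeff F n"
      unfolding frakL_coeff_def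
    proof (intro sum.cong refl)
      fix i assume "i \<in> {..n}"
      hence i: "i \<le> n" by simp
      have "?q ^ i dvd ?q ^ n" using i by (rule le_imp_power_dvd)
      moreover have "?q ^ n div ?q ^ i = ?q ^ (n - i)" using i by (subst power_diff) auto
      ultimately show "fps_nth (?h i) (?q ^ n) = mconst (inverse (\<iota> (carlitz_D i))) * star_sum F (n - i) ^ ?q ^ i"
        unfolding hnth by (simp add: G_pow)
    qed
    finally show ?thesis .
  qed
  show "fps_nth (frakL emb F) N = 0" if N: "\<nexists>n. N = ?q ^ n"
  proof -
    have "fps_nth (?h i) N = 0" for i
    proof (cases "?q ^ i dvd N")
      case True
      have "fps_nth G (N div ?q ^ i) = 0"
      proof (rule G_other, safe)
        fix d assume "N div ?q ^ i = ?q ^ d"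
        hence "N = ?q ^ (i + d)" using True by (metis dvd_mult_div_cancel power_add)
        thus False using N by blast
      qed
      thus ?thesis unfolding hnth by (simp add: zero_power)
    next
      case False
      thus ?thesis unfolding hnth by simp
    qed
    thus ?thesis unfolding L by (intro sum.neutral) simp
  qed
qed

text \<open>
  Both \<open>star_sum\<close> and the \<open>q\<^sup>i\<close>-th power map are additive, so
  the coefficients of \<open>L(F, Z)\<close> can be computed monomial by monomial.
\<close>

lemma frakL_coeff_decomposition:
  assumes F: "F \<in> A_mpol emb s"
  obtains xs :: "(nat \<Rightarrow>\<^sub>0 nat) \<Rightarrow> nat list" and c :: "(nat \<Rightarrow>\<^sub>0 nat) \<Rightarrow> 'q poly" where
    "\<And>m. m \<in> Poly_Mapping.keys F \<Longrightarrow> set (xs m) \<subseteq> {1..s}"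
    "\<And>n. frakL_coeff F n = (\<Sum>m\<in>Poly_Mapping.keys F.
        slot_eval (length (xs m)) (carlitz_slot (\<lambda>j. mvar (xs m ! j))) (log_alg_coeff (length (xs m)) (c m) n))"
proof -
  have "\<forall>m. \<exists>xs. set xs \<subseteq> Poly_Mapping.keys m \<and>
          (\<forall>y :: nat \<Rightarrow> 'c mpol. (\<Prod>i\<in>Poly_Mapping.keys m. y i ^ Poly_Mapping.lookup m i) = (\<Prod>j<length xs. y (xs ! j)))"
    by (intro allI prod_power_as_prod_nth finite_keys)
  then obtain xs where xs: "\<And>m. set (xs m) \<subseteq> Poly_Mapping.keys m"
    "\<And>m (y :: nat \<Rightarrow> 'c mpol). (\<Prod>i\<in>Poly_Mapping.keys m. y i ^ Poly_Mapping.lookup m i) = (\<Prod>j<length (xs m). y (xs m ! j))"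
    by metis
  have "\<forall>m. \<exists>c. Poly_Mapping.lookup F m = \<iota> c"
    using F by (auto simp: A_mpol_iff coeffs_in_def image_iff)
  then obtain c where c: "\<And>m. Poly_Mapping.lookup F m = \<iota> (c m)" by metis
  define E where "E m = slot_eval (length (xs m)) (carlitz_slot (\<lambda>j. mvar (xs m ! j)))" for m
  have S: "star_sum F d = (\<Sum>m\<in>Poly_Mapping.keys F. E m (harmonic_sum (length (xs m)) (c m) d))" for d
  proof -
    have "star_sum F d = (\<Sum>a | a \<in> A_plus \<and> degree a = d. \<Sum>m\<in>Poly_Mapping.keys F.
            mconst (\<iota> (c m) * inverse (\<iota> a)) * (\<Prod>j<length (xs m). carlitz_at emb a (mvar (xs m ! j))))"
      unfolding star_sum_def msubst_def xs(2) c sum_distrib_left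
      by (intro sum.cong refl) (simp add: mconst_mult mult_ac)
    also have "\<dots> = (\<Sum>m\<in>Poly_Mapping.keys F. E m (harmonic_sum (length (xs m)) (c m) d))"
      by (subst sum.swap)
         (simp add: E_def harmonic_sum_def slot_eval_sum slot_eval_mconst_mult slot_eval_A_poly_in_vars)
    finally show ?thesis .
  qed
  have char: "CHAR('c mpol) = CHAR('q)" using CHAR_mpol CHAR_eq by metis
  have "frakL_coeff F n = (\<Sum>m\<in>Poly_Mapping.keys F. E m (log_alg_coeff (length (xs m)) (c m) n))" for n
    unfolding frakL_coeff_def S sum_power_card_power[OF char] sum_distrib_left
    by (subst sum.swap) (simp add: E_def slot_eval_log_alg_coeff)
  moreover have "set (xs m) \<subseteq> {1..s}" if "m \<in> Poly_Mapping.keys F" for m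
    using xs(1)[of m] that F unfolding A_mpol_iff by blast
  ultimately show ?thesis using that unfolding E_def by blast
qed

end

section \<open>Log-algebraicity\<close>

theorem theorem4p6:
  fixes emb :: "'q::finite_field fls alg_closure \<Rightarrow> 'c::{field, complete_space}"
    and s :: nat and F :: "'c mpol"
  assumes "C_infinity emb"
    and "s \<ge> 1"
    and "F \<in> A_mpol emb s"
  shows "frakL emb F \<in> A_mpol_Z emb s"
proof -
  interpret C_infinity emb by (rule assms(1))
  obtain xs :: "(nat \<Rightarrow>\<^sub>0 nat) \<Rightarrow> nat list" and c :: "(nat \<Rightarrow>\<^sub>0 nat) \<Rightarrow> 'q poly" where
    xs: "\<And>m. m \<in> Poly_Mapping.keys F \<Longrightarrow> set (xs m) \<subseteq> {1..s}" and
    L: "\<And>n. frakL_coeff F n = (\<Sum>m\<in>Poly_Mapping.keys F.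
        slot_eval (length (xs m)) (carlitz_slot (\<lambda>j. mvar (xs m ! j))) (log_alg_coeff (length (xs m)) (c m) n))"
    using frakL_coeff_decomposition[OF assms(3)] by blast
  \<comment> \<open>a common bound for the thresholds \<open>k + deg c\<close> of all monomials\<close>
  define M where "M = (\<Sum>m\<in>Poly_Mapping.keys F. length (xs m) + degree (c m))"
  have zero: "frakL_coeff F n = 0" if "n > M" for n
    unfolding L
  proof (rule sum.neutral, rule ballI)
    fix m assume "m \<in> Poly_Mapping.keys F"
    hence "length (xs m) + degree (c m) \<le> M" unfolding M_def by (intro member_le_sum) auto
    hence "log_alg_coeff (length (xs m)) (c m) n = 0" using that by (intro log_alg_coeff_eq_0) simp
    thus "slot_eval (length (xs m)) (carlitz_slot (\<lambda>j. mvar (xs m ! j)))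
            (log_alg_coeff (length (xs m)) (c m) n) = 0" by simp
  qed
  have mem: "frakL_coeff F n \<in> A_mpol emb s" for n
    unfolding L
  proof (intro A_mpol_sum A_mpol_slot_eval log_alg_coeff_in_A)
    fix m j e assume "m \<in> Poly_Mapping.keys F" "j < length (xs m)"
    hence "xs m ! j \<in> {1..s}" using xs nth_mem by blast
    thus "carlitz_slot (\<lambda>j. mvar (xs m ! j)) j e \<in> A_mpol emb s"
      unfolding carlitz_slot_def by (intro A_mpol_carlitz_at A_mpol_mvar)
  qed
  have "{N. fps_nth (frakL emb F) N \<noteq> 0} \<subseteq> (\<lambda>n. CARD('q) ^ n) ` {..M}"
  proof
    fix N assume "N \<in> {N. fps_nth (frakL emb F) N \<noteq> 0}"
    hence N: "fps_nth (frakL emb F) N \<noteq> 0" by simp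
    then obtain n where n: "N = CARD('q) ^ n" using fps_nth_frakL_other by blast
    hence "frakL_coeff F n \<noteq> 0" using N fps_nth_frakL_power by simp
    hence "n \<le> M" using zero by (meson not_less)
    thus "N \<in> (\<lambda>n. CARD('q) ^ n) ` {..M}" using n by blast
  qed
  hence "finite {N. fps_nth (frakL emb F) N \<noteq> 0}" by (rule finite_subset) simp
  moreover have "fps_nth (frakL emb F) N \<in> A_mpol emb s" for N
  proof (cases "\<exists>n. N = CARD('q) ^ n")
    case True
    thus ?thesis using mem fps_nth_frakL_power by auto
  next
    case False
    thus ?thesis using A_mpol_0 fps_nth_frakL_other by simp
  qed
  ultimately show ?thesis by (simp add: A_mpol_Z_def)
qed

end
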